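(* Let $p$ be a prime. Let $\mathcal{Q}_{gc}$ be the generalized concatenated quantum code with inner code a graph code $\mathcal{Q}_{\mathrm{in}}^{(0)}=(\mathcal{G}_{\mathrm{in}}^{(0)},\mathcal{C}_{\mathrm{in}}^{(0)})$ with parameters $((n,q_1q_2\cdots q_r,d_1))_p$, nest-decomposed into mutually orthogonal subcodes, and with $r$ outer codes that are CWS codes $\mathcal{Q}_{\mathrm{out}}^{(j)}=(\mathcal{G}_{\mathrm{out}}^{(j)},\mathcal{C}_{\mathrm{out}}^{(j)})$ with parameters $((n',K'_j,d'_j))_{q_j}$, $j=1,\dots,r$. Then $\mathcal{Q}_{gc}$ is the CWS code $$\mathcal{Q}_{gc}=(\mathcal{G}_{gc},\mathcal{C}_{gc}),$$ where $\mathcal{G}_{gc}$ can be obtained from the encoding graph $\mathcal{G}_{\mathcal{Q}_{gc}}^{\{enc\}}$ via the procedure of graph concatenation by generalized local complementation, and $\mathcal{C}_{gc}$ is the classical generalized concatenated code with inner code $\mathcal{C}_{\mathrm{in}}^{(0)}$ (with the decomposition corresponding to the decomposition of $\mathcal{Q}_{\mathrm{in}}^{(0)}$) and outer codes $\mathcal{C}_{\mathrm{out}}^{(j)}$, $j=1,\dots,r$.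
   Context: Qupits and gates. $\omega=e^{2\pi i/p}$. A qupit has orthonormal basis $\{|s\rangle:s\in\mathbb{F}_p\}$; $X|s\rangle=|s+1\rangle$, $Z|s\rangle=\omega^s|s\rangle$; $X^{\mathbf a}=X^{a_1}\otimes\cdots\otimes X^{a_N}$ and $Z^{\mathbf b}=Z^{b_1}\otimes\cdots\otimes Z^{b_N}$ for $\mathbf a,\mathbf b\in\mathbb{F}_p^N$. The Hadamard gate $H$ is the unitary with $H|\widehat{s}\rangle=|s\rangle$, where $|\widehat{s}\rangle=p^{-1/2}\sum_t\omega^{-st}|t\rangle$. The controlled-$Z$ gate is $C_z|s\rangle|t\rangle=\omega^{st}|s\rangle|t\rangle$. Graph states, CWS codes, graph codes. A graph $\mathcal{G}$ on $N$ vertices with edges labeled by nonzero elements of $\mathbb{F}_p$ is given by its adjacency matrix $G$, a symmetric matrix over $\mathbb{F}_p$ with zero diagonal. Its graph state $|\psi\rangle_{\mathcal G}$ is the unique (up to scalar) state fixed by all $X^{\mathbf e_i}Z^{\mathbf g_i}$, $\mathbf e_i$ the $i$-th standard basis vector and $\mathbf g_i$ the $i$-th row of $G$. For $\mathcal{C}\subseteq\mathbb{F}_p^N$ the CWS code $(\mathcal{G},\mathcal{C})$ is the span of $\{Z^{\mathbf c}|\psi\rangle_{\mathcal G}:\mathbf c\in\mathcal{C}\}$. It is a graph code if $\mathcal{C}$ is linear. A graph code with $p^k$ codewords encodes $k$ input qupits: the codewords are indexed by $\mathbb{F}_p^k$, the index $(s_1,\dots,s_k)$ corresponding to $s_1\boldsymbol\alpha_1+\cdots+s_k\boldsymbol\alpha_k$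 for a basis $\boldsymbol\alpha_1,\dots,\boldsymbol\alpha_k$ of $\mathcal{C}$. $((n,K,d))_q$ denotes a $K$-dimensional quantum code of minimum distance $d$ on $n$ systems of $q$ levels. The outer code $\mathcal{Q}_{\mathrm{out}}^{(j)}$ is treated as a CWS code on $n'\log_pq_j$ qupits, $\log_pq_j$ qupits for each of its $n'$ positions; its classical code need not be linear. Decomposition of the inner code. $\mathcal{Q}_{\mathrm{in}}^{(0)}$ is partitioned into $q_1$ mutually orthogonal subcodes $\mathcal{Q}_{\mathrm{in}\{i_1\}}^{(1)}$ with parameters $((n,q_2\cdots q_r,d_2))_p$; each of these into $q_2$ mutually orthogonal subcodes $\mathcal{Q}_{\mathrm{in}\{i_1i_2\}}^{(2)}$ with parameters $((n,q_3\cdots q_r,d_3))_p$; and so on, down to subcodes $\mathcal{Q}_{\mathrm{in}\{i_1\cdots i_{r-1}\}}^{(r-1)}$ with parameters $((n,q_r,d_r))_p$; here $0\le i_j\le q_j-1$ and $d_1\le d_2\le\cdots\le d_r$. Thus $\mathcal{Q}_{\mathrm{in}}^{(0)}=\bigoplus_{i_1}\mathcal{Q}_{\mathrm{in}\{i_1\}}^{(1)}$, $\mathcal{Q}_{\mathrm{in}\{i_1\}}^{(1)}=\bigoplus_{i_2}\mathcal{Q}_{\mathrm{in}\{i_1i_2\}}^{(2)}$, etc. The corresponding decomposition of $\mathcal{C}_{\mathrm{in}}^{(0)}$ is the nested partition into the sets of codewords $\mathbf c$ for which the $Z^{\mathbf c}|\psi\rangle_{\mathcal{G}_{\mathrm{in}}^{(0)}}$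 span these subcodes; so each codeword of $\mathcal{C}_{\mathrm{in}}^{(0)}$ has a label $(i_1,\dots,i_r)$ and is written $\mathbf c(i_1,\dots,i_r)$. The value $i_j$ is carried by $\log_pq_j$ of the input qupits of the inner graph code, so that $(i_1,\dots,i_r)$ is the index of the codeword. Classical generalized concatenated code. $\mathcal{C}_{gc}$ consists of all words $\big(\mathbf c(x^{(1)}_1,\dots,x^{(r)}_1),\dots,\mathbf c(x^{(1)}_{n'},\dots,x^{(r)}_{n'})\big)$ with $(x^{(j)}_1,\dots,x^{(j)}_{n'})\in\mathcal{C}_{\mathrm{out}}^{(j)}$ for $j=1,\dots,r$. The code $\mathcal{Q}_{gc}$. It is a code of dimension $K'_1K'_2\cdots K'_r$ on $nn'$ qupits: the outer code is a product of the $r$ outer codes, and for each position $m=1,\dots,n'$ the $m$-th systems of all $r$ outer codes are together encoded into the $m$-th copy of the inner code, the $m$-th system of the $j$-th outer code carrying the level-$j$ label $i_j$. Its encoding circuit is: (1) for each $j$, apply the encoding circuit of $\mathcal{Q}_{\mathrm{out}}^{(j)}$, which encodes $K'_j$ states into $n'\log_pq_j$ qupits; (2) prepare $n'$ copies of the graph state of $\mathcal{G}_{\mathrm{in}}^{(0)}$; (3) for each $j$, apply $H^\dagger$ to all $n'\log_pq_j$ qupits from (1); (4) apply the corresponding controlled-$Z$ operators between these qupits and the graph states of $\mathcal{G}_{\mathrm{in}}^{(0)}$, i.e. between a qupit at position $m$ serving as input qupit $a$ of the $m$-th inner code and the $l$-th qupit of the $m$-th copy apply $C_z$ to the power $\alpha_{al}$,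 the $l$-th coordinate of $\boldsymbol\alpha_a$; (5) apply $H$ to all the qupits from (1); (6) measure them in the computational basis (the desired outcome $0$ is assumed). Encoding graph $\mathcal{G}_{\mathcal{Q}_{gc}}^{\{enc\}}$. Its auxiliary vertices are the qupits from (1); they induce the disjoint union of $\mathcal{G}_{\mathrm{out}}^{(1)},\dots,\mathcal{G}_{\mathrm{out}}^{(r)}$. Its output vertices are those of $n'$ copies of $\mathcal{G}_{\mathrm{in}}^{(0)}$, each copy inducing $\mathcal{G}_{\mathrm{in}}^{(0)}$. Auxiliary and output vertices are joined by edges labeled by the exponents of the controlled-$Z$ gates in (4). There are no other edges. Generalized local complementation. For a graph with adjacency matrix $F=(f_{ij})$, a vertex $i$, the $i$-th row $\mathbf f_i$ of $F$, and a vector $\mathbf v$ indexed by the vertices with $v_j=0$ if $j=i$ or $f_{ij}\ne0$, the generalized local complementation at $(i,\mathbf v)$ sends $F$ to $F+\mathbf v^T\mathbf f_i+\mathbf f_i^T\mathbf v$. (For $p=2$, $\mathbf v$ is a set $S$ of vertices, and the bipartite graph between the neighbors of $i$ and $S$ is replaced by its complement.) Procedure of graph concatenation by generalized local complementation. (1) For each auxiliary vertex $i$ let $S_i$ be the set of output vertices adjacent to $i$ in the encoding graph, recorded with edge labels as a vector $\mathbf v^{(i)}$ supported on $S_i$. (2) For each auxiliary vertex $i$ delete all edges joining $i$ to $S_i$. (3) For each auxiliary vertex $i$ perform the generalized local complementation at $(i,\mathbf v^{(i)})$ (the order does not matter). (4) Remove all auxiliary vertices.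
   Formalization: The claim is made when the generalized local complementations are admissible in some order; this is shown, for every order, if adjacent auxiliary vertices share no output neighbour. Otherwise the procedure can be undefined and the claim false. *)

theory Defs
  imports
    "HOL-Analysis.Analysis"
    "HOL-Library.Function_Algebras"
    "Berlekamp_Zassenhaus.Finite_Field"
begin

section \<open>Vectors over the prime field and states of qupits\<close>

text \<open>
  The field with \<open>p\<close> elements is \<^typ>\<open>'p mod_ring\<close> for \<open>'p :: prime_card\<close>, \<open>p = CARD('p)\<close>.
  Qupits are indexed by the elements of a finite set \<open>V\<close>.  A vector indexed by \<open>V\<close> is a function
  that vanishes outside \<open>V\<close>, and a state of the qupits in \<open>V\<close> is the function that maps such a
  vector to its amplitude in the computational basis; it vanishes on all other arguments.
\<close>

type_synonym ('v, 'p) vec = "'v \<Rightarrow> 'p mod_ring"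
type_synonym ('v, 'p) mat = "'v \<Rightarrow> 'v \<Rightarrow> 'p mod_ring"
type_synonym ('v, 'p) state = "('v, 'p) vec \<Rightarrow> complex"

definition vecs :: "'v set \<Rightarrow> ('v, 'p::prime_card) vec set" where
  "vecs V = {x. \<forall>v. v \<notin> V \<longrightarrow> x v = 0}"

definition states :: "'v set \<Rightarrow> ('v, 'p::prime_card) state set" where
  "states V = {\<phi>. \<forall>x. x \<notin> vecs V \<longrightarrow> \<phi> x = 0}"

definition scale_vec :: "'p::prime_card mod_ring \<Rightarrow> ('v, 'p) vec \<Rightarrow> ('v, 'p) vec" where
  "scale_vec c x = (\<lambda>v. c * x v)"

definition scale_state :: "complex \<Rightarrow> ('v, 'p::prime_card) state \<Rightarrow> ('v, 'p) state" where
  "scale_state c \<phi> = (\<lambda>x. c * \<phi> x)"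

global_interpretation fvec: vector_space scale_vec
  by unfold_locales (auto simp: scale_vec_def algebra_simps)

global_interpretation qstate: vector_space scale_state
  by unfold_locales (auto simp: scale_state_def algebra_simps)

definition restr :: "'v set \<Rightarrow> ('v, 'p::prime_card) vec \<Rightarrow> ('v, 'p) vec" where
  "restr W x = (\<lambda>v. if v \<in> W then x v else 0)"

definition replace_on :: "'v set \<Rightarrow> ('v, 'p::prime_card) vec \<Rightarrow> ('v, 'p) vec \<Rightarrow> ('v, 'p) vec" where
  "replace_on W x t = (\<lambda>v. if v \<in> W then t v else x v)"

definition braket ::
    "'v set \<Rightarrow> ('v, 'p::prime_card) state \<Rightarrow> ('v, 'p) state \<Rightarrow> complex" where
  "braket V \<phi> \<psi> = (\<Sum>x\<in>vecs V. cnj (\<phi> x) * \<psi> x)"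

definition tensor ::
    "'v set \<Rightarrow> 'v set \<Rightarrow> ('v, 'p::prime_card) state \<Rightarrow> ('v, 'p) state \<Rightarrow> ('v, 'p) state" where
  "tensor V W \<phi> \<psi> = (\<lambda>x. if x \<in> vecs (V \<union> W) then \<phi> (restr V x) * \<psi> (restr W x) else 0)"


section \<open>Gates\<close>

text \<open>\<open>omega_pow s\<close> is \<open>\<omega>\<close> to the power \<open>s\<close>, where \<open>\<omega> = exp (2 \<pi> i / p)\<close>.\<close>

definition omega_pow :: "'p::prime_card mod_ring \<Rightarrow> complex" where
  "omega_pow s = cis (2 * pi * real_of_int (to_int_mod_ring s) / real CARD('p))"

definition ket :: "('v, 'p::prime_card) vec \<Rightarrow> ('v, 'p) state" where
  "ket s = (\<lambda>x. if x = s then 1 else 0)"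

definition X_op :: "('v, 'p::prime_card) vec \<Rightarrow> ('v, 'p) state \<Rightarrow> ('v, 'p) state" where
  "X_op a \<phi> = (\<lambda>x. \<phi> (x - a))"

definition Z_op :: "'v set \<Rightarrow> ('v, 'p::prime_card) vec \<Rightarrow> ('v, 'p) state \<Rightarrow> ('v, 'p) state" where
  "Z_op V b \<phi> = (\<lambda>x. omega_pow (\<Sum>v\<in>V. b v * x v) * \<phi> x)"

text \<open>
  \<open>H\<close> is determined by mapping \<open>p\<^sup>-\<^sup>1\<^sup>/\<^sup>2 \<Sum>\<^sub>t \<omega>\<^sup>-\<^sup>s\<^sup>t |t\<rangle>\<close> to \<open>|s\<rangle>\<close>, so its matrix entry at row \<open>s\<close>,
  column \<open>t\<close> is \<open>p\<^sup>-\<^sup>1\<^sup>/\<^sup>2 \<omega>\<^sup>s\<^sup>t\<close>.  The operators below apply \<open>H\<close> (or its adjoint) to each qupit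
  in \<open>A\<close> and the identity to all other qupits.
\<close>

definition hadamard :: "'v set \<Rightarrow> ('v, 'p::prime_card) state \<Rightarrow> ('v, 'p) state" where
  "hadamard A \<phi> = (\<lambda>x. (\<Sum>t\<in>vecs A. omega_pow (\<Sum>v\<in>A. x v * t v) * \<phi> (replace_on A x t))
                        / complex_of_real (sqrt (real CARD('p)) ^ card A))"

definition hadamard_adj :: "'v set \<Rightarrow> ('v, 'p::prime_card) state \<Rightarrow> ('v, 'p) state" where
  "hadamard_adj A \<phi> = (\<lambda>x. (\<Sum>t\<in>vecs A. omega_pow (- (\<Sum>v\<in>A. x v * t v)) * \<phi> (replace_on A x t))
                        / complex_of_real (sqrt (real CARD('p)) ^ card A))"

text \<open>The product over \<open>u \<in> A\<close>, \<open>w \<in> B\<close> of the controlled-\<open>Z\<close> gates between \<open>u\<close> and \<open>w\<close> to the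
  power \<open>e u w\<close>.\<close>

definition cz_gates ::
    "'v set \<Rightarrow> 'v set \<Rightarrow> ('v, 'p::prime_card) mat \<Rightarrow> ('v, 'p) state \<Rightarrow> ('v, 'p) state" where
  "cz_gates A B e \<phi> = (\<lambda>x. (\<Prod>u\<in>A. \<Prod>w\<in>B. omega_pow (e u w * x u * x w)) * \<phi> x)"

text \<open>The state of the qupits in \<open>B\<close> after all other qupits were measured with outcome \<open>0\<close>, up to
  a scalar: a vector in \<open>vecs B\<close> has coordinate \<open>0\<close> at every measured qupit.\<close>

definition project_zero :: "'v set \<Rightarrow> ('v, 'p::prime_card) state \<Rightarrow> ('v, 'p) state" where
  "project_zero B \<phi> = (\<lambda>x. if x \<in> vecs B then \<phi> x else 0)"

lemma X_op_ket: "X_op a (ket s) = ket (s + a)"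
  by (auto simp: X_op_def ket_def fun_eq_iff algebra_simps)

lemma Z_op_ket: "Z_op V b (ket s) = scale_state (omega_pow (\<Sum>v\<in>V. b v * s v)) (ket s)"
  by (auto simp: Z_op_def ket_def scale_state_def fun_eq_iff)

lemma cz_gates_ket:
  "cz_gates {u} {w} (\<lambda>_ _. 1) (ket s) = scale_state (omega_pow (s u * s w)) (ket s)"
  by (auto simp: cz_gates_def ket_def scale_state_def fun_eq_iff)


section \<open>Quantum codes and their parameters\<close>

text \<open>
  A system of \<open>q\<close> levels, \<open>q\<close> a power of \<open>p\<close>, is a block of \<open>log\<^sub>p q\<close> qupits; \<open>sys v\<close> is the system
  to which the qupit \<open>v\<close> belongs.  \<open>local_op W M\<close> is the operator on the qupits in \<open>W\<close> with matrix
  \<open>M\<close>, tensored with the identity on all other qupits.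
\<close>

definition local_op ::
    "'v set \<Rightarrow> (('v, 'p::prime_card) vec \<Rightarrow> ('v, 'p) vec \<Rightarrow> complex)
      \<Rightarrow> ('v, 'p) state \<Rightarrow> ('v, 'p) state" where
  "local_op W M \<phi> = (\<lambda>x. \<Sum>t\<in>vecs W. M (restr W x) t * \<phi> (replace_on W x t))"

text \<open>
  Every error on the systems in \<open>T\<close> is detectable (Knill--Laflamme).  For a one-dimensional code
  this condition is void, and the usual convention is that the code has to be pure: the expectation
  of the error is its normalized trace.
\<close>

definition detects ::
    "('v \<Rightarrow> 's) \<Rightarrow> 'v set \<Rightarrow> ('v, 'p::prime_card) state set \<Rightarrow> 's set \<Rightarrow> bool" where
  "detects sys V Q T \<longleftrightarrow>
     (let W = {v \<in> V. sys v \<in> T} in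
      \<forall>M. \<exists>c. (\<forall>\<phi>\<in>Q. \<forall>\<psi>\<in>Q. braket V \<phi> (local_op W M \<psi>) = c * braket V \<phi> \<psi>) \<and>
              (qstate.dim Q = 1 \<longrightarrow> c = (\<Sum>t\<in>vecs W. M t t) / of_nat (card (vecs W :: ('v, 'p) vec set))))"

definition has_min_distance ::
    "('v \<Rightarrow> 's) \<Rightarrow> 'v set \<Rightarrow> ('v, 'p::prime_card) state set \<Rightarrow> nat \<Rightarrow> bool" where
  "has_min_distance sys V Q d \<longleftrightarrow>
     (\<forall>T. T \<subseteq> sys ` V \<and> card T < d \<longrightarrow> detects sys V Q T) \<and>
     (\<exists>T. T \<subseteq> sys ` V \<and> card T = d \<and> \<not> detects sys V Q T)"

text \<open>\<open>Q\<close> is an \<open>((n, K, d))\<^sub>q\<close> code.\<close>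

definition code_params ::
    "('v \<Rightarrow> 's) \<Rightarrow> 'v set \<Rightarrow> ('v, 'p::prime_card) state set
      \<Rightarrow> nat \<Rightarrow> nat \<Rightarrow> nat \<Rightarrow> nat \<Rightarrow> bool" where
  "code_params sys V Q n K d q \<longleftrightarrow>
     finite V \<and> card (sys ` V) = n \<and>
     (\<forall>s\<in>sys ` V. CARD('p) ^ card {v \<in> V. sys v = s} = q) \<and>
     qstate.subspace Q \<and> Q \<subseteq> states V \<and> qstate.dim Q = K \<and>
     has_min_distance sys V Q d"


section \<open>Graph states, CWS codes, graph codes\<close>

definition is_graph :: "'v set \<Rightarrow> ('v, 'p::prime_card) mat \<Rightarrow> bool" where
  "is_graph V G \<longleftrightarrow>
     finite V \<and> (\<forall>u w. G u w = G w u) \<and> (\<forall>u. G u u = 0) \<and>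
     (\<forall>u w. u \<notin> V \<or> w \<notin> V \<longrightarrow> G u w = 0)"

definition unit_vec :: "'v \<Rightarrow> ('v, 'p::prime_card) vec" where
  "unit_vec i = (\<lambda>v. if v = i then 1 else 0)"

text \<open>The graph state is unique only up to a phase; an arbitrary normalized one is chosen.\<close>

definition is_graph_state ::
    "'v set \<Rightarrow> ('v, 'p::prime_card) mat \<Rightarrow> ('v, 'p) state \<Rightarrow> bool" where
  "is_graph_state V G \<psi> \<longleftrightarrow>
     \<psi> \<in> states V \<and> braket V \<psi> \<psi> = 1 \<and> (\<forall>i\<in>V. X_op (unit_vec i) (Z_op V (G i) \<psi>) = \<psi>)"

definition graph_state :: "'v set \<Rightarrow> ('v, 'p::prime_card) mat \<Rightarrow> ('v, 'p) state" where
  "graph_state V G = (SOME \<psi>. is_graph_state V G \<psi>)"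

definition cws_code ::
    "'v set \<Rightarrow> ('v, 'p::prime_card) mat \<Rightarrow> ('v, 'p) vec set \<Rightarrow> ('v, 'p) state set" where
  "cws_code V G C = qstate.span {Z_op V c (graph_state V G) | c. c \<in> C}"

text \<open>\<open>C\<close> is linear and the family \<open>\<alpha> j a\<close>, \<open>j < r\<close>, \<open>a < k j\<close>, is a basis of \<open>C\<close>.\<close>

definition is_code_basis ::
    "nat \<Rightarrow> (nat \<Rightarrow> nat) \<Rightarrow> (nat \<Rightarrow> nat \<Rightarrow> (nat, 'p::prime_card) vec) \<Rightarrow> (nat, 'p) vec set \<Rightarrow> bool" where
  "is_code_basis r k \<alpha> C \<longleftrightarrow>
     inj_on (\<lambda>(j, a). \<alpha> j a) (SIGMA j:{..<r}. {..<k j}) \<and>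
     fvec.independent {\<alpha> j a | j a. j < r \<and> a < k j} \<and>
     fvec.span {\<alpha> j a | j a. j < r \<and> a < k j} = C"


section \<open>Nested decomposition of the inner code\<close>

text \<open>
  The levels are numbered from \<open>0\<close> to \<open>r - 1\<close>.  With \<open>q j = p ^ k j\<close>, the \<open>q j\<close> values of the level-\<open>j\<close>
  label are the vectors of length \<open>k j\<close> over the prime field, the value of the label being carried by
  the input qupits \<open>(j, a)\<close>, \<open>a < k j\<close>.  A list of labels is a partial index that consists of the
  labels of the first levels.
\<close>

definition labels :: "nat \<Rightarrow> (nat \<Rightarrow> nat) \<Rightarrow> (nat, 'p::prime_card) vec list set" where
  "labels r k = {ls. length ls \<le> r \<and> (\<forall>j<length ls. ls ! j \<in> vecs {..<k j})}"

definition codeword ::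
    "nat \<Rightarrow> (nat \<Rightarrow> nat) \<Rightarrow> (nat \<Rightarrow> nat \<Rightarrow> (nat, 'p::prime_card) vec)
      \<Rightarrow> (nat, 'p) vec list \<Rightarrow> (nat, 'p) vec" where
  "codeword r k \<alpha> ls = (\<lambda>l. \<Sum>j<r. \<Sum>a<k j. (ls ! j) a * \<alpha> j a l)"

text \<open>
  \<open>Qsub [i\<^sub>1, \<dots>, i\<^sub>j]\<close> is the subcode with label \<open>(i\<^sub>1, \<dots>, i\<^sub>j)\<close>, for \<open>j < r\<close>.  As the levels are numbered
  from \<open>0\<close>, its dimension is the product of the \<open>q i\<close> over \<open>j \<le> i < r\<close> and its distance is \<open>d j\<close>.
\<close>

definition nested_decomposition ::
    "nat \<Rightarrow> nat \<Rightarrow> (nat \<Rightarrow> nat) \<Rightarrow> (nat \<Rightarrow> nat) \<Rightarrow> (nat \<Rightarrow> nat)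
      \<Rightarrow> (nat, 'p::prime_card) state set \<Rightarrow> ((nat, 'p) vec list \<Rightarrow> (nat, 'p) state set) \<Rightarrow> bool" where
  "nested_decomposition n r k q d Q Qsub \<longleftrightarrow>
     Qsub [] = Q \<and>
     (\<forall>ls\<in>labels r k. length ls < r \<longrightarrow>
        code_params id {..<n} (Qsub ls) n (\<Prod>j=length ls..<r. q j) (d (length ls)) CARD('p)) \<and>
     (\<forall>ls\<in>labels r k. Suc (length ls) < r \<longrightarrow>
        Qsub ls = qstate.span (\<Union>i\<in>vecs {..<k (length ls)}. Qsub (ls @ [i])) \<and>
        (\<forall>i\<in>vecs {..<k (length ls)}. \<forall>i'\<in>vecs {..<k (length ls)}. i \<noteq> i' \<longrightarrow>
           (\<forall>\<phi>\<in>Qsub (ls @ [i]). \<forall>\<psi>\<in>Qsub (ls @ [i']). braket {..<n} \<phi> \<psi> = 0)))"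

text \<open>The subcode with label \<open>ls\<close> is spanned by the basis states of the codewords whose index
  starts with \<open>ls\<close>.\<close>

definition decomposition_corresponds ::
    "nat \<Rightarrow> nat \<Rightarrow> (nat \<Rightarrow> nat) \<Rightarrow> (nat, 'p::prime_card) mat
      \<Rightarrow> (nat \<Rightarrow> nat \<Rightarrow> (nat, 'p) vec) \<Rightarrow> ((nat, 'p) vec list \<Rightarrow> (nat, 'p) state set) \<Rightarrow> bool" where
  "decomposition_corresponds n r k G \<alpha> Qsub \<longleftrightarrow>
     (\<forall>ls\<in>labels r k. length ls < r \<longrightarrow>
        Qsub ls = cws_code {..<n} G
          {codeword r k \<alpha> (ls @ ls') | ls'. ls @ ls' \<in> labels r k \<and> length (ls @ ls') = r})"


section \<open>Generalized concatenation\<close>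

text \<open>
  \<open>Aux j m a\<close> is the \<open>a\<close>-th qupit at position \<open>m\<close> of the outer code of level \<open>j\<close>; \<open>Out m l\<close> is the
  \<open>l\<close>-th qupit of the \<open>m\<close>-th copy of the inner code.  In the outer code of level \<open>j\<close> by itself the
  former is the qupit \<open>(m, a)\<close>, which belongs to the system \<open>m = fst (m, a)\<close>.
\<close>

datatype vertex = Aux nat nat nat | Out nat nat

definition aux_vertices :: "nat \<Rightarrow> nat \<Rightarrow> (nat \<Rightarrow> nat) \<Rightarrow> vertex set" where
  "aux_vertices n' r k = {Aux j m a | j m a. j < r \<and> m < n' \<and> a < k j}"

definition out_vertices :: "nat \<Rightarrow> nat \<Rightarrow> vertex set" where
  "out_vertices n' n = {Out m l | m l. m < n' \<and> l < n}"

definition outer_qupits :: "nat \<Rightarrow> (nat \<Rightarrow> nat) \<Rightarrow> nat \<Rightarrow> (nat \<times> nat) set" where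
  "outer_qupits n' k j = {..<n'} \<times> {..<k j}"

fun cz_exponent ::
    "(nat \<Rightarrow> nat \<Rightarrow> (nat, 'p::prime_card) vec) \<Rightarrow> (vertex, 'p) mat" where
  "cz_exponent \<alpha> (Aux j m a) (Out m' l) = (if m = m' then \<alpha> j a l else 0)"
| "cz_exponent \<alpha> _ _ = 0"

definition outer_product ::
    "nat \<Rightarrow> nat \<Rightarrow> (nat \<Rightarrow> nat) \<Rightarrow> (nat \<Rightarrow> (nat \<times> nat, 'p::prime_card) state)
      \<Rightarrow> (vertex, 'p) state" where
  "outer_product n' r k \<phi> =
     (\<lambda>x. if x \<in> vecs (aux_vertices n' r k) then \<Prod>j<r. \<phi> j (\<lambda>(m, a). x (Aux j m a)) else 0)"

definition outer_code ::
    "nat \<Rightarrow> nat \<Rightarrow> (nat \<Rightarrow> nat) \<Rightarrow> (nat \<Rightarrow> (nat \<times> nat, 'p::prime_card) state set)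
      \<Rightarrow> (vertex, 'p) state set" where
  "outer_code n' r k Qout =
     qstate.span {outer_product n' r k \<phi> | \<phi>. \<forall>j<r. \<phi> j \<in> Qout j}"

definition inner_copies ::
    "nat \<Rightarrow> nat \<Rightarrow> (nat, 'p::prime_card) state \<Rightarrow> (vertex, 'p) state" where
  "inner_copies n' n \<psi> =
     (\<lambda>x. if x \<in> vecs (out_vertices n' n) then \<Prod>m<n'. \<psi> (\<lambda>l. x (Out m l)) else 0)"

text \<open>The part of the encoding circuit that follows the encoding of the outer codes.  It is linear,
  so the set of its (unnormalized) outputs on the states of the outer code is a subspace.\<close>

definition encoding_circuit ::
    "nat \<Rightarrow> nat \<Rightarrow> nat \<Rightarrow> (nat \<Rightarrow> nat) \<Rightarrow> (nat, 'p::prime_card) mat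
      \<Rightarrow> (nat \<Rightarrow> nat \<Rightarrow> (nat, 'p) vec) \<Rightarrow> (vertex, 'p) state \<Rightarrow> (vertex, 'p) state" where
  "encoding_circuit n n' r k Gin \<alpha> \<Phi> =
     (let A = aux_vertices n' r k; B = out_vertices n' n;
          \<Psi>0 = tensor A B \<Phi> (inner_copies n' n (graph_state {..<n} Gin));
          \<Psi>1 = hadamard_adj A \<Psi>0;
          \<Psi>2 = cz_gates A B (cz_exponent \<alpha>) \<Psi>1;
          \<Psi>3 = hadamard A \<Psi>2
      in project_zero B \<Psi>3)"

definition concatenated_quantum_code ::
    "nat \<Rightarrow> nat \<Rightarrow> nat \<Rightarrow> (nat \<Rightarrow> nat) \<Rightarrow> (nat, 'p::prime_card) mat
      \<Rightarrow> (nat \<Rightarrow> nat \<Rightarrow> (nat, 'p) vec) \<Rightarrow> (nat \<Rightarrow> (nat \<times> nat, 'p) state set)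
      \<Rightarrow> (vertex, 'p) state set" where
  "concatenated_quantum_code n n' r k Gin \<alpha> Qout =
     encoding_circuit n n' r k Gin \<alpha> ` outer_code n' r k Qout"

definition concatenated_word ::
    "nat \<Rightarrow> nat \<Rightarrow> nat \<Rightarrow> (nat \<Rightarrow> nat) \<Rightarrow> (nat \<Rightarrow> nat \<Rightarrow> (nat, 'p::prime_card) vec)
      \<Rightarrow> (nat \<Rightarrow> (nat \<times> nat, 'p) vec) \<Rightarrow> (vertex, 'p) vec" where
  "concatenated_word n n' r k \<alpha> x =
     (\<lambda>v. case v of Aux _ _ _ \<Rightarrow> 0
          | Out m l \<Rightarrow>
              if m < n' \<and> l < n then codeword r k \<alpha> (map (\<lambda>j a. x j (m, a)) [0..<r]) l else 0)"

definition concatenated_classical_code ::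
    "nat \<Rightarrow> nat \<Rightarrow> nat \<Rightarrow> (nat \<Rightarrow> nat) \<Rightarrow> (nat \<Rightarrow> nat \<Rightarrow> (nat, 'p::prime_card) vec)
      \<Rightarrow> (nat \<Rightarrow> (nat \<times> nat, 'p) vec set) \<Rightarrow> (vertex, 'p) vec set" where
  "concatenated_classical_code n n' r k \<alpha> Cout =
     {concatenated_word n n' r k \<alpha> x | x. \<forall>j<r. x j \<in> Cout j}"

fun encoding_label ::
    "(nat, 'p::prime_card) mat \<Rightarrow> (nat \<Rightarrow> nat \<Rightarrow> (nat, 'p) vec) \<Rightarrow> (nat \<Rightarrow> (nat \<times> nat, 'p) mat)
      \<Rightarrow> (vertex, 'p) mat" where
  "encoding_label Gin \<alpha> Gout (Aux j m a) (Aux j' m' a') =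
     (if j = j' then Gout j (m, a) (m', a') else 0)"
| "encoding_label Gin \<alpha> Gout (Out m l) (Out m' l') = (if m = m' then Gin l l' else 0)"
| "encoding_label Gin \<alpha> Gout (Aux j m a) (Out m' l) = cz_exponent \<alpha> (Aux j m a) (Out m' l)"
| "encoding_label Gin \<alpha> Gout (Out m' l) (Aux j m a) = cz_exponent \<alpha> (Aux j m a) (Out m' l)"

definition submatrix_on :: "'v set \<Rightarrow> ('v, 'p::prime_card) mat \<Rightarrow> ('v, 'p) mat" where
  "submatrix_on W F = (\<lambda>u w. if u \<in> W \<and> w \<in> W then F u w else 0)"

definition encoding_graph ::
    "nat \<Rightarrow> nat \<Rightarrow> nat \<Rightarrow> (nat \<Rightarrow> nat) \<Rightarrow> (nat, 'p::prime_card) mat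
      \<Rightarrow> (nat \<Rightarrow> nat \<Rightarrow> (nat, 'p) vec) \<Rightarrow> (nat \<Rightarrow> (nat \<times> nat, 'p) mat) \<Rightarrow> (vertex, 'p) mat" where
  "encoding_graph n n' r k Gin \<alpha> Gout =
     submatrix_on (aux_vertices n' r k \<union> out_vertices n' n) (encoding_label Gin \<alpha> Gout)"


section \<open>Graph concatenation by generalized local complementation\<close>

definition glc :: "('v, 'p::prime_card) mat \<Rightarrow> 'v \<Rightarrow> ('v, 'p) vec \<Rightarrow> ('v, 'p) mat" where
  "glc F i v = (\<lambda>u w. F u w + v u * F i w + F i u * v w)"

definition glc_admissible :: "('v, 'p::prime_card) mat \<Rightarrow> 'v \<Rightarrow> ('v, 'p) vec \<Rightarrow> bool" where
  "glc_admissible F i v \<longleftrightarrow> (\<forall>u. u = i \<or> F i u \<noteq> 0 \<longrightarrow> v u = 0)"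

inductive glc_sequence ::
    "('v \<Rightarrow> ('v, 'p::prime_card) vec) \<Rightarrow> 'v list \<Rightarrow> ('v, 'p) mat \<Rightarrow> ('v, 'p) mat \<Rightarrow> bool"
  for v where
  "glc_sequence v [] F F"
| "glc_admissible F i (v i) \<Longrightarrow> glc_sequence v vs (glc F i (v i)) F'
    \<Longrightarrow> glc_sequence v (i # vs) F F'"

definition out_neighbours :: "'v set \<Rightarrow> ('v, 'p::prime_card) mat \<Rightarrow> 'v \<Rightarrow> 'v set" where
  "out_neighbours B E i = {u \<in> B. E i u \<noteq> 0}"

definition delete_between ::
    "'v set \<Rightarrow> 'v set \<Rightarrow> ('v, 'p::prime_card) mat \<Rightarrow> ('v, 'p) mat" where
  "delete_between A B E =
     (\<lambda>u w. if u \<in> A \<and> w \<in> B \<or> u \<in> B \<and> w \<in> A then 0 else E u w)"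

text \<open>
  \<open>graph_concatenation_along vs A B E G\<close>: the procedure, applied to the graph \<open>E\<close> with auxiliary
  vertices \<open>A\<close> and output vertices \<open>B\<close>, processing the auxiliary vertices in the order \<open>vs\<close>, yields
  \<open>G\<close>.  This is a relation because a local complementation is defined only for admissible vectors,
  and admissibility refers to the graph at the time when the operation is performed: if two adjacent
  auxiliary vertices share an output neighbour, then after the first of them has been processed the
  second one is adjacent to that neighbour.
\<close>

definition graph_concatenation_along ::
    "'v list \<Rightarrow> 'v set \<Rightarrow> 'v set \<Rightarrow> ('v, 'p::prime_card) mat \<Rightarrow> ('v, 'p) mat \<Rightarrow> bool" where
  "graph_concatenation_along vs A B E G \<longleftrightarrow>
     distinct vs \<and> set vs = A \<and>
     (\<exists>F. glc_sequence (\<lambda>i. restr (out_neighbours B E i) (E i)) vs (delete_between A B E) F \<and>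
          G = submatrix_on B F)"

definition graph_concatenation ::
    "'v set \<Rightarrow> 'v set \<Rightarrow> ('v, 'p::prime_card) mat \<Rightarrow> ('v, 'p) mat \<Rightarrow> bool" where
  "graph_concatenation A B E G \<longleftrightarrow> (\<exists>vs. graph_concatenation_along vs A B E G)"

end

theory Submission
  imports Defs
begin

text \<open>
  The amplitudes of a graph state are \<open>\<omega>\<^sup>f\<^sup>(\<^sup>x\<^sup>)\<close>, up to a common scalar, for a quadratic form \<open>f\<close> whose
  polarization is the adjacency matrix, and \<open>Z\<close> gates add a linear form to \<open>f\<close>.  Since the
  auxiliary qupits are finally measured, the Fourier sums in the encoding circuit collapse to a
  character sum: the output amplitude at \<open>x\<close> is the inner amplitude at \<open>x\<close> times the outer amplitude
  at \<open>y = \<alpha> x\<close>, the vector of inner products of \<open>x\<close> with the rows of controlled-\<open>Z\<close> exponents.  So the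
  output of a product of basis states has exponent \<open>f\<^sub>i\<^sub>n(x) + f\<^sub>o\<^sub>u\<^sub>t(y) + c \<cdot> y\<close>, whose linear part is the
  concatenated word.  On the graph side, a local complementation at \<open>(i, v)\<close> substitutes \<open>x\<^sub>i + v \<cdot> x\<close>
  for \<open>x\<^sub>i\<close> in the quadratic form; doing this for all auxiliary vertices, in any admissible order,
  and setting the auxiliary variables to \<open>0\<close> gives the same form \<open>f\<^sub>i\<^sub>n(x) + f\<^sub>o\<^sub>u\<^sub>t(y)\<close>.
\<close>

section \<open>Quadratic forms of graph states\<close>

lemma omega_pow_add: "omega_pow (a + b) = omega_pow a * omega_pow b"
  for a b :: "'p::prime_card mod_ring"
proof -
  let ?n = "int CARD('p)"
  let ?s = "to_int_mod_ring a + to_int_mod_ring b"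
  \<comment> \<open>Reduction modulo \<open>p\<close> changes the sum of the representatives by a
    multiple of \<open>p\<close>, hence the angle by a multiple of a full turn.\<close>
  have "to_int_mod_ring (a + b) = ?s mod ?n"
    by (rule to_int_mod_ring_add)
  then have "to_int_mod_ring (a + b) = ?s - ?n * (?s div ?n)"
    by (simp add: minus_mult_div_eq_mod)
  then have "real_of_int (to_int_mod_ring (a + b)) = real_of_int (to_int_mod_ring a)
      + real_of_int (to_int_mod_ring b) - real CARD('p) * real_of_int (?s div ?n)"
    by simp
  then have "2 * pi * real_of_int (to_int_mod_ring (a + b)) / real CARD('p)
      = 2 * pi * real_of_int (to_int_mod_ring a) / real CARD('p)
        + 2 * pi * real_of_int (to_int_mod_ring b) / real CARD('p)
        + - (2 * pi * real_of_int (?s div ?n))"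
    by (simp only:) (simp add: field_simps)
  moreover have "cis (- (2 * pi * real_of_int (?s div ?n))) = 1"
    using cis_multiple_2pi[of "- real_of_int (?s div ?n)"] by simp
  ultimately show ?thesis
    unfolding omega_pow_def by (simp only: cis_mult [symmetric] mult_1_right)
qed

lemma omega_pow_0 [simp]: "omega_pow 0 = 1"
  by (simp add: omega_pow_def)

lemma norm_omega_pow [simp]: "norm (omega_pow a) = 1"
  by (simp add: omega_pow_def)

lemma omega_pow_uminus_mult [simp]: "omega_pow (- a) * omega_pow a = 1"
  by (simp flip: omega_pow_add)

lemma omega_pow_sum: "omega_pow (sum f S) = (\<Prod>s\<in>S. omega_pow (f s))"
  by (induction S rule: infinite_finite_induct) (auto simp: omega_pow_add)

text \<open>The representative of a nonzero element lies strictly between \<open>0\<close> and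
  \<open>p\<close>, so the angle is not a multiple of a full turn.\<close>

lemma omega_pow_neq_1:
  fixes a :: "'p::prime_card mod_ring"
  assumes "a \<noteq> 0"
  shows "omega_pow a \<noteq> 1"
proof
  assume "omega_pow a = 1"
  let ?k = "to_int_mod_ring a"
  have "?k \<in> {0..<int CARD('p)}"
    using range_to_int_mod_ring by blast
  moreover have "?k \<noteq> 0"
    using assms by (metis of_int_0 of_int_mod_ring_to_int_mod_ring of_int_of_int_mod_ring)
  ultimately have k: "0 < ?k" "?k < int CARD('p)" by (auto simp: less_le)
  from \<open>omega_pow a = 1\<close> have "cos (2 * pi * real_of_int ?k / real CARD('p)) = 1"
    by (simp add: omega_pow_def complex_eq_iff)
  then obtain m :: int where "2 * pi * real_of_int ?k / real CARD('p) = of_int m * (2 * pi)"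
    using cos_one_2pi_int[of "2 * pi * real_of_int ?k / real CARD('p)"] by auto
  then have "real_of_int ?k = of_int m * real CARD('p)"
    by (simp add: field_simps)
  then have "?k = m * int CARD('p)"
    by (metis of_int_eq_iff of_int_mult of_int_of_nat_eq)
  with k show False
    by (metis dvd_triv_right zdvd_not_zless)
qed

section \<open>Vectors on a finite index set and orthogonality of characters\<close>

lemma unit_vec_in_vecs [simp]: "i \<in> V \<Longrightarrow> unit_vec i \<in> vecs V"
  by (auto simp: vecs_def unit_vec_def)

lemma add_in_vecs: "x \<in> vecs V \<Longrightarrow> y \<in> vecs V \<Longrightarrow> x + y \<in> vecs V"
  and diff_in_vecs: "x \<in> vecs V \<Longrightarrow> y \<in> vecs V \<Longrightarrow> x - y \<in> vecs V"
  by (auto simp: vecs_def)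

lemma restr_in_vecs [simp]: "restr V x \<in> vecs V"
  by (auto simp: vecs_def restr_def)

text \<open>Elements of \<open>vecs V\<close> are \<open>0\<close> outside \<open>V\<close>,
  extensional functions are \<open>undefined\<close> there. Exchanging the two conventions transfers
  finiteness and cardinality from \<open>PiE\<close>.\<close>

lemma bij_betw_vecs_PiE:
  "bij_betw (\<lambda>x. restrict x V) (vecs V :: ('v, 'p::prime_card) vec set) (V \<rightarrow>\<^sub>E UNIV)"
proof (rule bij_betw_byWitness[where f' = "restr V"])
  show "\<forall>x\<in>vecs V. restr V (restrict x V) = x"
    by (auto simp: vecs_def restr_def fun_eq_iff)
  show "\<forall>x\<in>V \<rightarrow>\<^sub>E UNIV. restrict (restr V x) V = x"
    by (auto simp: restr_def fun_eq_iff restrict_def PiE_def extensional_def)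
  show "(\<lambda>x. restrict x V) ` vecs V \<subseteq> V \<rightarrow>\<^sub>E UNIV"
    by auto
  show "restr V ` (V \<rightarrow>\<^sub>E UNIV) \<subseteq> vecs V"
    by auto
qed

lemma finite_vecs [simp]: "finite V \<Longrightarrow> finite (vecs V :: ('v, 'p::prime_card) vec set)"
  using bij_betw_finite[OF bij_betw_vecs_PiE[of V]] by (simp add: finite_PiE)

lemma card_vecs:
  "finite V \<Longrightarrow> card (vecs V :: ('v, 'p::prime_card) vec set) = CARD('p) ^ card V"
  using bij_betw_same_card[OF bij_betw_vecs_PiE[of V]] by (simp add: card_PiE)

text \<open>If \<open>z i\<close> is nonzero, translating \<open>t\<close> by
  \<open>unit_vec i\<close> permutes \<open>vecs V\<close> and multiplies every term by
  \<open>omega_pow (z i)\<close>, which differs from \<open>1\<close>; so the sum is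
  \<open>0\<close>.\<close>

lemma sum_omega_pow_vecs:
  fixes z :: "('v, 'p::prime_card) vec"
  assumes "finite V"
  shows "(\<Sum>t\<in>vecs V. omega_pow (\<Sum>v\<in>V. t v * z v))
    = (if \<forall>v\<in>V. z v = 0 then of_nat (CARD('p) ^ card V) else 0)"
proof (cases "\<forall>v\<in>V. z v = 0")
  case True
  then show ?thesis by (simp add: card_vecs assms)
next
  case False
  then obtain i where i: "i \<in> V" "z i \<noteq> 0" by auto
  let ?S = "\<Sum>t\<in>vecs V. omega_pow (\<Sum>v\<in>V. t v * z v)"
  have "(\<Sum>v\<in>V. (t + unit_vec i) v * z v) = (\<Sum>v\<in>V. t v * z v) + z i" for t :: "('v, 'p) vec"
  proof -
    have "(\<Sum>v\<in>V. unit_vec i v * z v) = (\<Sum>v\<in>V. if v = i then z i else 0)"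
      by (intro sum.cong) (auto simp: unit_vec_def)
    then show ?thesis
      using i assms by (simp add: algebra_simps sum.distrib)
  qed
  then have "(\<Sum>v\<in>V. t v * z v) = (\<Sum>v\<in>V. (t - unit_vec i) v * z v) + z i" for t
    by (metis diff_add_cancel)
  then have "omega_pow (\<Sum>v\<in>V. t v * z v)
      = omega_pow (\<Sum>v\<in>V. (t - unit_vec i) v * z v) * omega_pow (z i)" for t
    by (metis omega_pow_add)
  then have "?S = (\<Sum>t\<in>vecs V. omega_pow (\<Sum>v\<in>V. (t - unit_vec i) v * z v) * omega_pow (z i))"
    by (rule sum.cong[OF refl])
  also have "\<dots> = ?S * omega_pow (z i)"
    unfolding sum_distrib_right
    by (rule sum.reindex_bij_witness[where i = "\<lambda>t. t + unit_vec i" and j = "\<lambda>t. t - unit_vec i"])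
       (auto simp: i add_in_vecs diff_in_vecs)
  finally have "?S * (omega_pow (z i) - 1) = 0"
    by (simp add: algebra_simps)
  then show ?thesis
    using False omega_pow_neq_1[OF i(2)] by auto
qed

text \<open>Characterizing a quadratic form by its increments avoids both a division by \<open>2\<close>, impossible for
  \<open>p = 2\<close>, and a linear order on the vertices.\<close>

definition graph_form ::
    "'v set \<Rightarrow> ('v, 'p::prime_card) mat \<Rightarrow> (('v, 'p) vec \<Rightarrow> 'p mod_ring) \<Rightarrow> bool" where
  "graph_form V F f \<longleftrightarrow>
     (\<forall>x c. \<forall>i\<in>V. f (x + scale_vec c (unit_vec i)) = f x + c * (\<Sum>v\<in>V. F i v * x v))"

lemma graph_formD:
  "graph_form V F f \<Longrightarrow> i \<in> V \<Longrightarrow>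
     f (x + scale_vec c (unit_vec i)) = f x + c * (\<Sum>v\<in>V. F i v * x v)"
  by (auto simp: graph_form_def)

lemma sum_mult_shift:
  assumes "finite V" "i \<in> V"
  shows "(\<Sum>v\<in>V. g v * (x + scale_vec c (unit_vec i)) v) = (\<Sum>v\<in>V. g v * x v) + c * g i"
proof -
  have "(\<Sum>v\<in>V. g v * (x + scale_vec c (unit_vec i)) v)
      = (\<Sum>v\<in>V. g v * x v + (if v = i then c * g i else 0))"
    by (intro sum.cong) (auto simp: scale_vec_def unit_vec_def algebra_simps)
  then show ?thesis
    using assms by (simp add: sum.distrib)
qed

text \<open>The form is the sum of \<open>F u w * x u * x w\<close> over unordered pairs of
  vertices, built up vertex by vertex: a new vertex \<open>a\<close> contributes its edges to the
  earlier ones. Symmetry and the zero diagonal give the right increments.\<close>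

lemma ex_graph_form:
  fixes F :: "('v, 'p::prime_card) mat"
  assumes "finite V" and sym: "\<And>u w. F u w = F w u" and diag: "\<And>u. F u u = 0"
  shows "\<exists>f. graph_form V F f"
proof -
  \<comment> \<open>The induction also carries that \<open>f\<close> ignores the variables outside
    \<open>V\<close>; otherwise its increment along the newly inserted vertex would be
    unknown.\<close>
  have "\<exists>f. graph_form V F f \<and> (\<forall>x c. \<forall>i. i \<notin> V \<longrightarrow> f (x + scale_vec c (unit_vec i)) = f x)"
    using \<open>finite V\<close>
  proof induction
    case empty
    show ?case by (intro exI[of _ "\<lambda>_. 0"]) (auto simp: graph_form_def)
  next
    case (insert a V)
    then obtain f where f: "graph_form V F f"
      and f': "\<And>x c i. i \<notin> V \<Longrightarrow> f (x + scale_vec c (unit_vec i)) = f x" by blast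
    define g where "g = (\<lambda>x. f x + x a * (\<Sum>v\<in>V. F a v * x v))"
    have shift_out: "(\<Sum>v\<in>V. F a v * (x + scale_vec c (unit_vec i)) v) = (\<Sum>v\<in>V. F a v * x v)"
      if "i \<notin> V" for x c i
      using that by (intro sum.cong) (auto simp: scale_vec_def unit_vec_def)
    have coord: "(x + scale_vec c (unit_vec i)) a = x a + (if i = a then c else 0)" for x c i
      by (auto simp: scale_vec_def unit_vec_def)
    have "graph_form (insert a V) F g"
      unfolding graph_form_def
    proof (intro allI ballI)
      fix x c i assume "i \<in> insert a V"
      then consider "i = a" | "i \<in> V" "i \<noteq> a" by blast
      then show "g (x + scale_vec c (unit_vec i)) = g x + c * (\<Sum>v\<in>insert a V. F i v * x v)"
      proof cases
        case 1
        then show ?thesis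
          using insert.hyps f' shift_out[OF insert.hyps(2)]
          by (simp add: g_def diag coord distrib_right del: plus_fun_apply)
      next
        case 2
        then show ?thesis
          using insert.hyps
          by (simp add: g_def coord graph_formD[OF f] sum_mult_shift sym[of i a] algebra_simps
              del: plus_fun_apply)
      qed
    qed
    moreover have "g (x + scale_vec c (unit_vec i)) = g x" if "i \<notin> insert a V" for x c i
      using that f' by (auto simp: g_def coord shift_out simp del: plus_fun_apply)
    ultimately show ?case by blast
  qed
  then show ?thesis by blast
qed

text \<open>A vector supported on \<open>V\<close> is reached from \<open>0\<close> by finitely many
  shifts, one coordinate at a time.\<close>

lemma vecs_shift_invariant:
  fixes g :: "('v, 'p::prime_card) vec \<Rightarrow> 'b"
  assumes "finite V" and inv: "\<And>x c i. i \<in> V \<Longrightarrow> g (x + scale_vec c (unit_vec i)) = g x"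
    and x: "x \<in> vecs V"
  shows "g x = g 0"
proof -
  have "g (restr W x) = g 0" if "W \<subseteq> V" for W
    using finite_subset[OF that \<open>finite V\<close>] that
  proof (induction W rule: finite_induct)
    case empty
    have "restr {} x = 0" by (auto simp: restr_def)
    then show ?case by simp
  next
    case (insert a W)
    have "restr (insert a W) x = restr W x + scale_vec (x a) (unit_vec a)"
      using insert.hyps by (auto simp: restr_def scale_vec_def unit_vec_def fun_eq_iff)
    then show ?case
      using insert inv by (metis insert_subset)
  qed
  moreover have "restr V x = x"
    using x by (auto simp: restr_def vecs_def fun_eq_iff)
  ultimately show ?thesis by (metis order_refl)
qed

section \<open>Graph states as states with quadratic phases\<close>

definition phase_state :: "'v set \<Rightarrow> (('v, 'p::prime_card) vec \<Rightarrow> 'p mod_ring) \<Rightarrow> ('v, 'p) state" where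
  "phase_state V f = (\<lambda>x. if x \<in> vecs V then omega_pow (f x) else 0)"

text \<open>The phase is acquired before the shift, hence at \<open>x - unit_vec i\<close>. As
  \<open>G i i = 0\<close>, it is the same at \<open>x\<close>.\<close>

lemma stabilizer_apply:
  fixes G :: "('v, 'p::prime_card) mat"
  assumes "is_graph V G" "i \<in> V"
  shows "X_op (unit_vec i) (Z_op V (G i) \<psi>) x = omega_pow (\<Sum>v\<in>V. G i v * x v) * \<psi> (x - unit_vec i)"
proof -
  have "(\<Sum>v\<in>V. G i v * (x - unit_vec i) v) = (\<Sum>v\<in>V. G i v * x v)"
    using assms by (intro sum.cong) (auto simp: unit_vec_def is_graph_def)
  then show ?thesis by (simp add: X_op_def Z_op_def del: minus_apply)
qed

lemma graph_form_diff_unit: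
  fixes G :: "('v, 'p::prime_card) mat"
  assumes "is_graph V G" "graph_form V G f" "i \<in> V"
  shows "f x = f (x - unit_vec i) + (\<Sum>v\<in>V. G i v * x v)"
proof -
  have "(\<Sum>v\<in>V. G i v * (x - unit_vec i) v) = (\<Sum>v\<in>V. G i v * x v)"
    using assms by (intro sum.cong) (auto simp: unit_vec_def is_graph_def)
  moreover have "scale_vec 1 (unit_vec i) = unit_vec i"
    by (simp add: scale_vec_def)
  ultimately show ?thesis
    using graph_formD[OF assms(2,3), of "x - unit_vec i" 1] by (simp del: minus_apply)
qed

text \<open>All amplitudes on \<open>vecs V\<close> have modulus one, so counting them gives the
  norm. The increment of \<open>f\<close> along \<open>unit_vec i\<close> is exactly the phase
  produced by the \<open>i\<close>-th stabilizer.\<close>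

lemma is_graph_state_phase_state:
  fixes G :: "('v, 'p::prime_card) mat"
  assumes G: "is_graph V G" and f: "graph_form V G f"
  shows "is_graph_state V G
    (scale_state (1 / complex_of_real (sqrt (real CARD('p) ^ card V))) (phase_state V f))"
    (is "is_graph_state V G (scale_state ?c _)")
proof -
  have "finite V" using G by (simp add: is_graph_def)
  have c: "cnj ?c * ?c = 1 / of_nat (CARD('p) ^ card V)"
    by (simp flip: of_real_mult of_real_power) (simp flip: of_nat_power)
  have unit: "cnj (omega_pow s) * omega_pow s = 1" for s :: "'p mod_ring"
    by (metis complex_norm_square mult.commute norm_omega_pow of_real_1 one_power2)
  have "braket V (scale_state ?c (phase_state V f)) (scale_state ?c (phase_state V f))
      = (\<Sum>x\<in>(vecs V :: ('v, 'p) vec set). 1 / of_nat (CARD('p) ^ card V))"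
    unfolding braket_def
  proof (intro sum.cong refl)
    fix x :: "('v, 'p) vec" assume "x \<in> vecs V"
    then have "cnj (scale_state ?c (phase_state V f) x) * scale_state ?c (phase_state V f) x
       = (cnj ?c * ?c) * (cnj (omega_pow (f x)) * omega_pow (f x))"
      by (simp only: scale_state_def phase_state_def if_True complex_cnj_mult mult.assoc mult.left_commute)
    then show "cnj (scale_state ?c (phase_state V f) x) * scale_state ?c (phase_state V f) x
      = 1 / of_nat (CARD('p) ^ card V)"
      unfolding c unit by simp
  qed
  also have "\<dots> = 1"
    using \<open>finite V\<close> by (simp add: card_vecs)
  finally have norm: "braket V (scale_state ?c (phase_state V f)) (scale_state ?c (phase_state V f)) = 1" .
  have "X_op (unit_vec i) (Z_op V (G i) (scale_state ?c (phase_state V f))) x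
      = scale_state ?c (phase_state V f) x" if i: "i \<in> V" for i x
  proof -
    have "x - unit_vec i \<in> vecs V \<longleftrightarrow> x \<in> vecs V"
      using i by (metis add_in_vecs diff_add_cancel diff_in_vecs unit_vec_in_vecs)
    then show ?thesis
      unfolding stabilizer_apply[OF G i]
      using graph_form_diff_unit[OF G f i, of x]
      by (simp add: scale_state_def phase_state_def omega_pow_add)
  qed
  with norm show ?thesis
    unfolding is_graph_state_def by (auto simp: states_def scale_state_def phase_state_def fun_eq_iff)
qed

text \<open>Dividing out the phase \<open>omega_pow (f x)\<close> leaves a function that is
  invariant under all unit shifts, hence constant on \<open>vecs V\<close>; normalization forbids
  the constant \<open>0\<close>.\<close>

lemma is_graph_state_unique:
  fixes G :: "('v, 'p::prime_card) mat"
  assumes G: "is_graph V G" and f: "graph_form V G f" and \<psi>: "is_graph_state V G \<psi>"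
  shows "\<exists>c. c \<noteq> 0 \<and> \<psi> = scale_state c (phase_state V f)"
proof -
  have "finite V" using G by (simp add: is_graph_def)
  define g where "g = (\<lambda>x. omega_pow (- f x) * \<psi> x)"
  have step: "g x = g (x - unit_vec i)" if i: "i \<in> V" for i x
  proof -
    have "\<psi> x = omega_pow (\<Sum>v\<in>V. G i v * x v) * \<psi> (x - unit_vec i)"
      using \<psi> i stabilizer_apply[OF G i, of \<psi> x] by (simp add: is_graph_state_def)
    moreover have "- f x = - f (x - unit_vec i) + - (\<Sum>v\<in>V. G i v * x v)"
      using graph_form_diff_unit[OF G f i, of x] by simp
    then have "omega_pow (- f x) = omega_pow (- f (x - unit_vec i)) * omega_pow (- (\<Sum>v\<in>V. G i v * x v))"
      by (simp only: omega_pow_add)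
    ultimately have "g x = omega_pow (- f (x - unit_vec i)) * \<psi> (x - unit_vec i)
        * (omega_pow (- (\<Sum>v\<in>V. G i v * x v)) * omega_pow (\<Sum>v\<in>V. G i v * x v))"
      by (simp only: g_def mult.assoc mult.commute mult.left_commute)
    then show ?thesis
      by (simp only: omega_pow_uminus_mult g_def mult_1_right)
  qed
  \<comment> \<open>Every scalar of the prime field is some \<open>of_nat m\<close>, so iterated
    unit shifts cover all multiples of \<open>unit_vec i\<close>.\<close>
  have "g (x + scale_vec (of_nat m) (unit_vec i)) = g x" if i: "i \<in> V" for i x m
  proof (induction m)
    case 0
    have "scale_vec 0 (unit_vec i) = (0 :: ('v, 'p) vec)" by (auto simp: scale_vec_def)
    then show ?case by simp
  next
    case (Suc m)
    have "x + scale_vec (of_nat (Suc m)) (unit_vec i) - unit_vec i = x + scale_vec (of_nat m) (unit_vec i)"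
      by (auto simp: scale_vec_def fun_eq_iff algebra_simps)
    then show ?case
      using step[OF i, of "x + scale_vec (of_nat (Suc m)) (unit_vec i)"] Suc by (simp only:)
  qed
  then have inv: "g (x + scale_vec c (unit_vec i)) = g x" if "i \<in> V" for i x c
    using that surj_of_nat_mod_ring[of c] by auto
  have "\<psi> x = scale_state (g 0) (phase_state V f) x" for x
  proof (cases "x \<in> vecs V")
    case True
    have "g x = g 0" by (rule vecs_shift_invariant[OF \<open>finite V\<close> inv True])
    then have "omega_pow (f x) * (omega_pow (- f x) * \<psi> x) = omega_pow (f x) * g 0"
      by (simp add: g_def)
    then have "\<psi> x = omega_pow (f x) * g 0"
      by (metis mult.assoc mult.commute mult_1 omega_pow_uminus_mult)
    then show ?thesis using True by (simp add: scale_state_def phase_state_def)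
  next
    case False
    then show ?thesis
      using \<psi> by (auto simp: is_graph_state_def states_def scale_state_def phase_state_def)
  qed
  then have eq: "\<psi> = scale_state (g 0) (phase_state V f)" by blast
  moreover have "g 0 \<noteq> 0"
  proof
    assume "g 0 = 0"
    then have "\<psi> = (\<lambda>x. 0)" using eq by (simp add: scale_state_def)
    then have "braket V \<psi> \<psi> = 0" by (simp add: braket_def)
    with \<psi> show False by (simp add: is_graph_state_def)
  qed
  ultimately show ?thesis by blast
qed

text \<open>Existence makes the choice in \<open>graph_state\<close> meaningful, and uniqueness
  fixes it up to a nonzero scalar, which spans do not see.\<close>

lemma graph_state_eq_phase_state:
  assumes "is_graph V G" "graph_form V G f"
  shows "\<exists>c. c \<noteq> 0 \<and> graph_state V G = scale_state c (phase_state V f)"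
proof (rule is_graph_state_unique[OF assms])
  show "is_graph_state V G (graph_state V G)"
    unfolding graph_state_def
    using is_graph_state_phase_state[OF assms] by (rule someI[of "is_graph_state V G"])
qed

section \<open>Generalized local complementation\<close>

lemma glc_sym:
  assumes "\<And>u w. F u w = F w u"
  shows "glc F i v u w = glc F i v w u"
  using assms by (simp add: glc_def algebra_simps)

text \<open>The diagonal entry changes by twice \<open>v u * F i u\<close>, and admissibility makes
  one of the factors vanish.\<close>

lemma glc_diag:
  assumes "glc_admissible F i v" "F u u = 0"
  shows "glc F i v u u = 0"
  using assms by (auto simp: glc_def glc_admissible_def)

text \<open>A shift by \<open>c\<close> in the variable \<open>w\<close> also changes the
  substituted sum by \<open>c * v w\<close>. Expanding both increments of \<open>f\<close> yields
  row \<open>w\<close> of the complemented matrix, apart from one term quadratic in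
  \<open>c\<close>.\<close>

lemma graph_form_glc:
  fixes F :: "('v, 'p::prime_card) mat"
  assumes "finite V" "i \<in> V" and f: "graph_form V F f" and sym: "\<And>u w. F u w = F w u"
    and adm: "glc_admissible F i v"
  shows "graph_form V (glc F i v) (\<lambda>x. f (x + scale_vec (\<Sum>u\<in>V. v u * x u) (unit_vec i)))"
  unfolding graph_form_def
proof (intro allI ballI)
  fix x :: "('v, 'p) vec" and c w assume w: "w \<in> V"
  let ?R = "\<lambda>w. \<Sum>u\<in>V. F w u * x u"
  let ?s = "\<Sum>u\<in>V. v u * x u"
  let ?x' = "x + scale_vec c (unit_vec w)"
  have "F i w * v w = 0"
    using adm by (auto simp: glc_admissible_def)
  \<comment> \<open>This is the term quadratic in \<open>c\<close>; it is here that admissibility is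
    used.\<close>
  then have 0: "c * v w * (c * F i w) = 0" by auto
  have row: "(\<Sum>u\<in>V. glc F i v w u * x u) = ?R w + v w * ?R i + F i w * ?s"
    by (simp add: glc_def algebra_simps sum.distrib sum_distrib_left)
  have "(\<Sum>u\<in>V. v u * ?x' u) = ?s + c * v w"
    by (rule sum_mult_shift) (use assms w in auto)
  then have "f (?x' + scale_vec (\<Sum>u\<in>V. v u * ?x' u) (unit_vec i))
      = f x + c * ?R w + (?s + c * v w) * (?R i + c * F i w)"
    using assms w by (simp add: graph_formD[OF f] sum_mult_shift del: plus_fun_apply)
  also have "\<dots> = f x + ?s * ?R i + c * (?R w + v w * ?R i + F i w * ?s)"
    using 0 by (simp add: algebra_simps)
  finally show "f (?x' + scale_vec (\<Sum>u\<in>V. v u * ?x' u) (unit_vec i))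
      = f (x + scale_vec ?s (unit_vec i)) + c * (\<Sum>u\<in>V. glc F i v w u * x u)"
    unfolding row using assms by (simp add: graph_formD[OF f] del: plus_fun_apply)
qed

text \<open>The vectors \<open>v i\<close> vanish at all processed vertices, so no substitution
  affects the sums used by the others, and the successive substitutions amount to one simultaneous
  shift.\<close>

lemma glc_sequence_graph_form:
  fixes F :: "('v, 'p::prime_card) mat"
  assumes "glc_sequence v vs F F'" "finite V" "set vs \<subseteq> V" "distinct vs"
    and "\<And>i u. i \<in> set vs \<Longrightarrow> u \<in> set vs \<Longrightarrow> v i u = 0"
    and "\<And>u w. F u w = F w u" "\<And>u. F u u = 0" "graph_form V F f"
  shows "(\<forall>u w. F' u w = F' w u) \<and> (\<forall>u. F' u u = 0) \<and>
    graph_form V F' (\<lambda>x. f (x + (\<lambda>u. if u \<in> set vs then \<Sum>w\<in>V. v u w * x w else 0)))"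
  using assms
proof (induction arbitrary: f rule: glc_sequence.induct)
  case (1 F)
  have "(\<lambda>u. 0) = (0 :: ('v, 'p) vec)" by auto
  with 1 show ?case by simp
next
  case (2 F i vs F')
  let ?f = "\<lambda>x. f (x + scale_vec (\<Sum>u\<in>V. v i u * x u) (unit_vec i))"
  let ?y = "\<lambda>vs x u. if u \<in> set vs then \<Sum>w\<in>V. v u w * x w else 0"
  have form: "graph_form V (glc F i (v i)) ?f"
    by (rule graph_form_glc) (use 2 in auto)
  have sym: "glc F i (v i) u w = glc F i (v i) w u" for u w
    using 2 by (intro glc_sym) auto
  have diag: "glc F i (v i) u u = 0" for u
    using 2 by (intro glc_diag) auto
  have IH: "(\<forall>u w. F' u w = F' w u) \<and> (\<forall>u. F' u u = 0) \<and>
      graph_form V F' (\<lambda>x. ?f (x + ?y vs x))"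
    by (rule "2.IH"[OF _ _ _ _ sym diag form]) (use 2 in auto)
  have eq: "?f (x + ?y vs x) = f (x + ?y (i # vs) x)" for x
  proof -
    \<comment> \<open>The shift \<open>?y vs x\<close> lives on the vertices of \<open>vs\<close>,
      where \<open>v i\<close> is zero; hence it does not change the sum substituted at
      \<open>i\<close>.\<close>
    have "v i u * ?y vs x u = 0" for u
      using 2 by auto
    then have "v i u * (x + ?y vs x) u = v i u * x u" for u
      by (simp add: distrib_left)
    then have dot: "(\<Sum>u\<in>V. v i u * (x + ?y vs x) u) = (\<Sum>u\<in>V. v i u * x u)"
      by (rule sum.cong[OF refl])
    have "x + ?y vs x + scale_vec (\<Sum>u\<in>V. v i u * x u) (unit_vec i) = x + ?y (i # vs) x"
      using 2 by (auto simp: fun_eq_iff scale_vec_def unit_vec_def)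
    then show ?thesis unfolding dot by (rule arg_cong)
  qed
  show ?case using IH unfolding eq .
qed

text \<open>Removing vertices amounts to setting their variables to \<open>0\<close> in the
  form.\<close>

lemma graph_form_submatrix:
  fixes F :: "('v, 'p::prime_card) mat"
  assumes "finite V" "B \<subseteq> V" and f: "graph_form V F f"
  shows "graph_form B (submatrix_on B F) (\<lambda>x. f (restr B x))"
  unfolding graph_form_def
proof (intro allI ballI)
  fix x :: "('v, 'p) vec" and c i assume i: "i \<in> B"
  have "restr B (x + scale_vec c (unit_vec i)) = restr B x + scale_vec c (unit_vec i)"
    using i by (auto simp: restr_def scale_vec_def unit_vec_def fun_eq_iff)
  moreover have "(\<Sum>v\<in>V. F i v * restr B x v) = (\<Sum>v\<in>B. submatrix_on B F i v * x v)"
    using assms i by (intro sum.mono_neutral_cong_right) (auto simp: restr_def submatrix_on_def)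
  ultimately show "f (restr B (x + scale_vec c (unit_vec i)))
      = f (restr B x) + c * (\<Sum>v\<in>B. submatrix_on B F i v * x v)"
    using i assms by (auto simp: graph_formD[OF f])
qed

text \<open>The increment at \<open>unit_vec w\<close> in direction \<open>u\<close> is the entry at
  \<open>(u, w)\<close>. This later shows that different processing orders give the same
  graph.\<close>

lemma graph_form_unique:
  fixes F :: "('v, 'p::prime_card) mat"
  assumes "finite V" "graph_form V F f" "graph_form V F' f" "u \<in> V" "w \<in> V"
  shows "F u w = F' u w"
proof -
  have "(\<Sum>v\<in>V. M u v * unit_vec w v) = M u w" for M :: "('v, 'p) mat"
  proof -
    have "(\<Sum>v\<in>V. M u v * unit_vec w v) = (\<Sum>v\<in>V. if v = w then M u w else 0)"
      by (intro sum.cong) (auto simp: unit_vec_def)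
    then show ?thesis using assms by simp
  qed
  then show ?thesis
    using assms(2,3)[THEN graph_formD, OF assms(4), of "unit_vec w" 1] by simp
qed

text \<open>The invariant says that \<open>i\<close> is joined to an output vertex \<open>w\<close>
  only if some \<open>N\<close>-neighbour \<open>u\<close> of \<open>i\<close> has
  \<open>v u w\<close> nonzero. By \<open>nb\<close> then \<open>v i w = 0\<close>, so the next
  operation is admissible. Labels within \<open>A\<close> never change, because each
  \<open>v i\<close> is supported on \<open>B\<close>.\<close>

lemma glc_sequence_exists:
  fixes F :: "('v, 'p::prime_card) mat"
  assumes "set vs \<subseteq> A"
    and supp: "\<And>i u. i \<in> A \<Longrightarrow> u \<notin> B \<Longrightarrow> v i u = 0" and disj: "A \<inter> B = {}"
    and nb: "\<And>i i' w. i \<in> A \<Longrightarrow> i' \<in> A \<Longrightarrow> N i i' \<noteq> 0 \<Longrightarrow> v i w = 0 \<or> v i' w = 0"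
    and FA: "\<And>i i'. i \<in> A \<Longrightarrow> i' \<in> A \<Longrightarrow> F i i' = N i i'"
    and inv: "\<And>i w. i \<in> A \<Longrightarrow> w \<in> B \<Longrightarrow> F i w \<noteq> 0 \<Longrightarrow> \<exists>u\<in>A. N u i \<noteq> 0 \<and> v u w \<noteq> 0"
    and sym: "\<And>u w. F u w = F w u"
  shows "\<exists>F'. glc_sequence v vs F F'"
  using assms(1) FA inv sym
proof (induction vs arbitrary: F)
  case Nil
  show ?case by (auto intro: glc_sequence.intros)
next
  case (Cons i vs)
  have i: "i \<in> A" using Cons by simp
  have "glc_admissible F i (v i)"
    unfolding glc_admissible_def
  proof (intro allI impI)
    fix w assume "w = i \<or> F i w \<noteq> 0"
    then show "v i w = 0"
    proof (cases "w \<in> B")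
      case True
      then have "F i w \<noteq> 0" using \<open>w = i \<or> F i w \<noteq> 0\<close> i disj by auto
      then obtain u where "u \<in> A" "N u i \<noteq> 0" "v u w \<noteq> 0"
        using Cons.prems(3) i True by blast
      then show ?thesis using nb i by blast
    qed (use supp i in auto)
  qed
  moreover have "\<exists>F'. glc_sequence v vs (glc F i (v i)) F'"
  proof (rule Cons.IH)
    show "set vs \<subseteq> A" using Cons by simp
    show "glc F i (v i) u w = N u w" if "u \<in> A" "w \<in> A" for u w
    proof -
      have "v i u = 0" "v i w = 0" using that supp[OF i] disj by blast+
      then show ?thesis using that Cons.prems by (simp add: glc_def)
    qed
    show "\<exists>u'\<in>A. N u' u \<noteq> 0 \<and> v u' w \<noteq> 0" if "u \<in> A" "w \<in> B" "glc F i (v i) u w \<noteq> 0" for u w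
    proof -
      have "v i u = 0" using that supp[OF i] disj by blast
      \<comment> \<open>As \<open>v i u = 0\<close>, the entry changes only by
        \<open>F i u * v i w\<close>; a newly created edge therefore has \<open>i\<close> itself as
        the witness of the invariant.\<close>
      then have "F u w \<noteq> 0 \<or> N i u \<noteq> 0 \<and> v i w \<noteq> 0"
        using that Cons.prems(2)[OF i \<open>u \<in> A\<close>] by (auto simp: glc_def)
      then show ?thesis using Cons.prems(3) that i by blast
    qed
    show "glc F i (v i) u w = glc F i (v i) w u" for u w
      using Cons.prems by (intro glc_sym)
  qed
  ultimately show ?case by (auto intro: glc_sequence.intros)
qed

section \<open>Collapse of the Fourier sums\<close>

text \<open>At \<open>x\<close> vanishing on \<open>A\<close> the last Hadamard sum over
  \<open>t\<close> has trivial phases. The controlled gates contribute the phase of \<open>t\<close>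
  paired with \<open>y\<close>, the first sum that of \<open>t\<close> paired with
  \<open>- s\<close>. Orthogonality leaves only \<open>s = y\<close>, and the number of vectors
  \<open>t\<close> cancels the two normalizations.\<close>

lemma encode_amplitude:
  fixes \<Phi> I :: "('v, 'p::prime_card) state"
  assumes fin: "finite A" "finite B" and disj: "A \<inter> B = {}" and x: "x \<in> vecs B"
  shows "hadamard A (cz_gates A B e (hadamard_adj A (tensor A B \<Phi> I))) x
    = \<Phi> (\<lambda>u. if u \<in> A then \<Sum>w\<in>B. e u w * x w else 0) * I x"
proof -
  define y where "y = (\<lambda>u. if u \<in> A then \<Sum>w\<in>B. e u w * x w else 0)"
  let ?C = "complex_of_real (sqrt (real CARD('p)) ^ card A)"
  have y: "y \<in> vecs A" by (simp add: y_def vecs_def)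
  have xA: "x v = 0" if "v \<in> A" for v
    using x disj that by (auto simp: vecs_def)
  \<comment> \<open>The inner replacement stems from the last Hadamard sum; the outer one, from the
    adjoint, overrides it.\<close>
  have tensor: "tensor A B \<Phi> I (replace_on A (replace_on A x t) s) = \<Phi> s * I x"
    if "s \<in> vecs A" for s t
  proof -
    have "restr A (replace_on A (replace_on A x t) s) = s"
      using that by (auto simp: restr_def replace_on_def vecs_def)
    moreover have "restr B (replace_on A (replace_on A x t) s) = x"
      using x disj by (auto simp: restr_def replace_on_def vecs_def fun_eq_iff)
    moreover have "replace_on A (replace_on A x t) s \<in> vecs (A \<union> B)"
      using x by (auto simp: replace_on_def vecs_def)
    ultimately show ?thesis by (simp add: tensor_def)
  qed
  have adj: "hadamard_adj A (tensor A B \<Phi> I) (replace_on A x t)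
      = (\<Sum>s\<in>vecs A. omega_pow (- (\<Sum>v\<in>A. t v * s v)) * (\<Phi> s * I x)) / ?C" for t
    unfolding hadamard_adj_def
    by (intro arg_cong2[where f = "(/)"] sum.cong refl arg_cong2[where f = "(*)"] tensor)
       (simp add: replace_on_def)
  have cz: "(\<Prod>u\<in>A. \<Prod>w\<in>B. omega_pow (e u w * replace_on A x t u * replace_on A x t w))
      = omega_pow (\<Sum>u\<in>A. t u * y u)" for t
  proof -
    have "(\<Sum>w\<in>B. e u w * replace_on A x t u * replace_on A x t w) = t u * y u"
      if "u \<in> A" for u
      unfolding y_def using that disj
      by (auto simp: sum_distrib_left replace_on_def intro!: sum.cong)
    then show ?thesis
      unfolding omega_pow_sum[symmetric] by (intro arg_cong[where f = omega_pow] sum.cong) auto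
  qed
  have orth: "(\<Sum>t\<in>vecs A. omega_pow (\<Sum>v\<in>A. t v * (y - s) v))
      = (if s = y then of_nat (CARD('p) ^ card A) else 0)" if "s \<in> vecs A" for s
  proof -
    have "(\<forall>v\<in>A. (y - s) v = 0) \<longleftrightarrow> s = y"
      using that y by (auto simp: vecs_def fun_eq_iff) (metis)
    then show ?thesis by (simp add: sum_omega_pow_vecs[OF fin(1)] del: minus_apply)
  qed
  have CC: "?C * ?C = of_nat (CARD('p) ^ card A)"
    by (simp flip: of_real_mult power_mult_distrib)
  have "hadamard A (cz_gates A B e (hadamard_adj A (tensor A B \<Phi> I))) x
      = (\<Sum>t\<in>vecs A. omega_pow (\<Sum>u\<in>A. t u * y u) *
          ((\<Sum>s\<in>vecs A. omega_pow (- (\<Sum>v\<in>A. t v * s v)) * (\<Phi> s * I x)) / ?C)) / ?C"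
    unfolding hadamard_def cz_gates_def adj cz
    by (intro arg_cong2[where f = "(/)"] sum.cong refl) (simp add: xA)
  also have "\<dots> = (\<Sum>t\<in>vecs A. \<Sum>s\<in>vecs A. omega_pow (\<Sum>v\<in>A. t v * (y - s) v) * (\<Phi> s * I x))
      / (?C * ?C)"
  proof -
    have "omega_pow (\<Sum>u\<in>A. t u * y u) * omega_pow (- (\<Sum>v\<in>A. t v * s v))
        = omega_pow (\<Sum>v\<in>A. t v * (y - s) v)" for s t
      by (simp flip: omega_pow_add add: right_diff_distrib sum_subtractf)
    then show ?thesis
      by (simp add: sum_distrib_left sum_divide_distrib mult.assoc[symmetric] del: minus_apply)
  qed
  also have "\<dots> = (\<Sum>s\<in>vecs A. (\<Sum>t\<in>vecs A. omega_pow (\<Sum>v\<in>A. t v * (y - s) v)) * (\<Phi> s * I x))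
      / (?C * ?C)"
    unfolding sum_distrib_right by (subst sum.swap) simp
  also have "\<dots> = (\<Sum>s\<in>vecs A. if s = y then ?C * ?C * (\<Phi> s * I x) else 0) / (?C * ?C)"
    unfolding CC by (intro arg_cong2[where f = "(/)"] sum.cong refl) (simp add: orth del: minus_apply)
  also have "\<dots> = \<Phi> y * I x"
    using y fin by simp
  finally show ?thesis by (simp add: y_def)
qed

section \<open>The encoding circuit\<close>

lemma sum_aux_vertices:
  fixes g :: "vertex \<Rightarrow> 'b::comm_monoid_add"
  shows "sum g (aux_vertices n' r k) = (\<Sum>j<r. \<Sum>(m, a)\<in>outer_qupits n' k j. g (Aux j m a))"
proof -
  have "sum g (aux_vertices n' r k) = (\<Sum>(j, m, a)\<in>(SIGMA j:{..<r}. outer_qupits n' k j). g (Aux j m a))"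
    by (rule sum.reindex_bij_witness[where j = "\<lambda>v. case v of Aux j m a \<Rightarrow> (j, m, a) | _ \<Rightarrow> undefined"
          and i = "\<lambda>(j, m, a). Aux j m a"])
       (auto simp: aux_vertices_def outer_qupits_def)
  also have "\<dots> = (\<Sum>j<r. \<Sum>(m, a)\<in>outer_qupits n' k j. g (Aux j m a))"
    by (subst sum.Sigma) (auto simp: outer_qupits_def)
  finally show ?thesis .
qed

lemma sum_out_vertices:
  fixes g :: "vertex \<Rightarrow> 'b::comm_monoid_add"
  shows "sum g (out_vertices n' n) = (\<Sum>m<n'. \<Sum>l<n. g (Out m l))"
proof -
  have "sum g (out_vertices n' n) = (\<Sum>(m, l)\<in>{..<n'} \<times> {..<n}. g (Out m l))"
    by (rule sum.reindex_bij_witness[where j = "\<lambda>v. case v of Out m l \<Rightarrow> (m, l) | _ \<Rightarrow> undefined"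
          and i = "\<lambda>(m, l). Out m l"])
       (auto simp: out_vertices_def)
  then show ?thesis by (simp add: sum.cartesian_product)
qed

lemma finite_outer_qupits [simp]: "finite (outer_qupits n' k j)"
  by (simp add: outer_qupits_def)

lemma finite_aux_vertices [simp]: "finite (aux_vertices n' r k)"
proof (rule finite_subset)
  show "aux_vertices n' r k \<subseteq> (\<lambda>(j, m, a). Aux j m a) ` (SIGMA j:{..<r}. {..<n'} \<times> {..<k j})"
    by (force simp: aux_vertices_def)
qed auto

lemma finite_out_vertices [simp]: "finite (out_vertices n' n)"
proof (rule finite_subset)
  show "out_vertices n' n \<subseteq> (\<lambda>(m, l). Out m l) ` ({..<n'} \<times> {..<n})"
    by (force simp: out_vertices_def)
qed auto

lemma aux_out_disjoint: "aux_vertices n' r k \<inter> out_vertices n' n = {}"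
  by (auto simp: aux_vertices_def out_vertices_def)

lemma Aux_in_aux_vertices: "Aux j m a \<in> aux_vertices n' r k \<longleftrightarrow> j < r \<and> (m, a) \<in> outer_qupits n' k j"
  and Out_in_out_vertices: "Out m l \<in> out_vertices n' n \<longleftrightarrow> m < n' \<and> l < n"
  by (auto simp: aux_vertices_def out_vertices_def outer_qupits_def)

text \<open>The quadratic form of the disjoint union of the outer graphs and the \<open>n'\<close>
  copies of the inner graph, that is, of the encoding graph without the edges between auxiliary and
  output vertices.\<close>

definition product_form ::
    "nat \<Rightarrow> nat \<Rightarrow> (nat \<Rightarrow> (nat \<times> nat, 'p::prime_card) vec \<Rightarrow> 'p mod_ring)
      \<Rightarrow> ((nat, 'p) vec \<Rightarrow> 'p mod_ring) \<Rightarrow> (vertex, 'p) vec \<Rightarrow> 'p mod_ring" where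
  "product_form n' r fout fin x =
     (\<Sum>j<r. fout j (\<lambda>(m, a). x (Aux j m a))) + (\<Sum>m<n'. fin (\<lambda>l. x (Out m l)))"

text \<open>A shift at one vertex affects only the summand of the level or copy containing it, and
  the row of that vertex has nonzero entries only there.\<close>

lemma graph_form_product_form:
  fixes Gin :: "(nat, 'p::prime_card) mat" and Gout :: "nat \<Rightarrow> (nat \<times> nat, 'p) mat"
  assumes fin: "graph_form {..<n} Gin fin"
    and fout: "\<And>j. j < r \<Longrightarrow> graph_form (outer_qupits n' k j) (Gout j) (fout j)"
  defines "A \<equiv> aux_vertices n' r k" and "B \<equiv> out_vertices n' n"
  shows "graph_form (A \<union> B) (delete_between A B (encoding_graph n n' r k Gin \<alpha> Gout))
    (product_form n' r fout fin)"
  unfolding graph_form_def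
proof (intro allI ballI)
  fix x :: "(vertex, 'p) vec" and c i
  let ?F = "delete_between A B (encoding_graph n n' r k Gin \<alpha> Gout)"
  assume i: "i \<in> A \<union> B"
  have AB: "A \<inter> B = {}" unfolding A_def B_def by (rule aux_out_disjoint)
  have split: "(\<Sum>v\<in>A \<union> B. ?F i v * x v) = (\<Sum>v\<in>A. ?F i v * x v) + (\<Sum>v\<in>B. ?F i v * x v)"
    using AB by (intro sum.union_disjoint) (auto simp: A_def B_def)
  show "product_form n' r fout fin (x + scale_vec c (unit_vec i))
      = product_form n' r fout fin x + c * (\<Sum>v\<in>A \<union> B. ?F i v * x v)"
  proof (cases i)
    case (Aux j0 m0 a0)
    then have iA: "i \<in> A" "i \<notin> B" using i AB by (auto simp: B_def out_vertices_def)
    then have j0: "j0 < r" and ma0: "(m0, a0) \<in> outer_qupits n' k j0"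
      by (simp_all add: A_def Aux Aux_in_aux_vertices)
    let ?X = "\<lambda>x j. (\<lambda>(m, a). x (Aux j m a)) :: (nat \<times> nat, 'p) vec"
    let ?R = "\<Sum>u\<in>outer_qupits n' k j0. Gout j0 (m0, a0) u * ?X x j0 u"
    have "?X (x + scale_vec c (unit_vec i)) j = ?X x j + (if j = j0 then scale_vec c (unit_vec (m0, a0)) else 0)"
      for j
      by (auto simp: fun_eq_iff scale_vec_def unit_vec_def Aux)
    then have "fout j (?X (x + scale_vec c (unit_vec i)) j) = fout j (?X x j) + (if j = j0 then c * ?R else 0)" for j
      using graph_formD[OF fout[OF j0] ma0, of "?X x j0" c] by auto
    then have 1: "(\<Sum>j<r. fout j (?X (x + scale_vec c (unit_vec i)) j)) = (\<Sum>j<r. fout j (?X x j)) + c * ?R"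
      using j0 by (simp add: sum.distrib)
    have 2: "(\<lambda>l. (x + scale_vec c (unit_vec i)) (Out m l)) = (\<lambda>l. x (Out m l))" for m
      by (auto simp: Aux scale_vec_def unit_vec_def)
    have "(\<Sum>v\<in>B. ?F i v * x v) = 0"
      using iA by (intro sum.neutral) (auto simp: delete_between_def)
    moreover have "(\<Sum>v\<in>A. ?F i v * x v) = ?R"
    proof -
      have "(\<Sum>v\<in>A. ?F i v * x v)
          = (\<Sum>j<r. \<Sum>u\<in>outer_qupits n' k j. if j = j0 then Gout j0 (m0, a0) u * ?X x j0 u else 0)"
        unfolding A_def sum_aux_vertices using j0 ma0
        by (intro sum.cong refl)
           (auto simp: delete_between_def encoding_graph_def submatrix_on_def Aux B_def
             Aux_in_aux_vertices out_vertices_def)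
      also have "\<dots> = (\<Sum>j<r. if j = j0 then ?R else 0)"
        by (intro sum.cong) auto
      finally show ?thesis using j0 by simp
    qed
    ultimately show ?thesis
      unfolding product_form_def 2 1 split by simp
  next
    case (Out m0 l0)
    then have iB: "i \<in> B" "i \<notin> A" using i AB by (auto simp: A_def aux_vertices_def)
    then have m0: "m0 < n'" and l0: "l0 \<in> {..<n}"
      by (simp_all add: B_def Out Out_in_out_vertices)
    let ?X = "\<lambda>x m. (\<lambda>l. x (Out m l)) :: (nat, 'p) vec"
    let ?R = "\<Sum>l<n. Gin l0 l * ?X x m0 l"
    have "?X (x + scale_vec c (unit_vec i)) m = ?X x m + (if m = m0 then scale_vec c (unit_vec l0) else 0)"
      for m
      by (auto simp: fun_eq_iff scale_vec_def unit_vec_def Out)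
    then have "fin (?X (x + scale_vec c (unit_vec i)) m) = fin (?X x m) + (if m = m0 then c * ?R else 0)" for m
      using graph_formD[OF fin l0, of "?X x m0" c] by auto
    then have 1: "(\<Sum>m<n'. fin (?X (x + scale_vec c (unit_vec i)) m)) = (\<Sum>m<n'. fin (?X x m)) + c * ?R"
      using m0 by (simp add: sum.distrib)
    have 2: "(\<lambda>(m, a). (x + scale_vec c (unit_vec i)) (Aux j m a)) = (\<lambda>(m, a). x (Aux j m a))" for j
      by (auto simp: Out scale_vec_def unit_vec_def)
    have "(\<Sum>v\<in>A. ?F i v * x v) = 0"
      using iB by (intro sum.neutral) (auto simp: delete_between_def)
    moreover have "(\<Sum>v\<in>B. ?F i v * x v) = ?R"
    proof -
      have "(\<Sum>v\<in>B. ?F i v * x v) = (\<Sum>m<n'. \<Sum>l<n. if m = m0 then Gin l0 l * ?X x m0 l else 0)"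
        unfolding B_def sum_out_vertices using m0 l0
        by (intro sum.cong refl)
           (auto simp: delete_between_def encoding_graph_def submatrix_on_def Out A_def
             Out_in_out_vertices aux_vertices_def)
      also have "\<dots> = (\<Sum>m<n'. if m = m0 then ?R else 0)"
        by (intro sum.cong) auto
      finally show ?thesis using m0 by simp
    qed
    ultimately show ?thesis
      unfolding product_form_def 2 1 split by simp
  qed
qed

section \<open>The circuit as a linear map and generators of the outer code\<close>

lemma encoding_circuit_eq:
  "encoding_circuit n n' r k Gin \<alpha> \<Phi> = (\<lambda>x. if x \<in> vecs (out_vertices n' n)
     then \<Phi> (\<lambda>u. if u \<in> aux_vertices n' r k then \<Sum>w\<in>out_vertices n' n. cz_exponent \<alpha> u w * x w else 0)
       * inner_copies n' n (graph_state {..<n} Gin) x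
     else 0)"
  by (rule ext) (simp add: encoding_circuit_def Let_def project_zero_def encode_amplitude aux_out_disjoint)

lemma linear_encoding_circuit:
  "module_hom scale_state scale_state (encoding_circuit n n' r k Gin \<alpha>)"
  by unfold_locales (auto simp: encoding_circuit_eq scale_state_def fun_eq_iff algebra_simps)

lemma outer_product_cong:
  "(\<And>j. j < r \<Longrightarrow> \<phi> j = \<phi>' j) \<Longrightarrow> outer_product n' r k \<phi> = outer_product n' r k \<phi>'"
  unfolding outer_product_def by (intro ext if_cong prod.cong refl) auto

text \<open>Separating the factor of level \<open>s\<close> exhibits the product as linear in that
  factor.\<close>

lemma outer_product_fun_upd:
  fixes \<phi> :: "nat \<Rightarrow> (nat \<times> nat, 'p::prime_card) state"
  assumes "s < r"
  shows "outer_product n' r k (\<phi>(s := \<psi>)) x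
    = (if x \<in> vecs (aux_vertices n' r k)
       then \<psi> (\<lambda>(m, a). x (Aux s m a)) * (\<Prod>j\<in>{..<r} - {s}. \<phi> j (\<lambda>(m, a). x (Aux j m a))) else 0)"
proof -
  have "(\<Prod>j<r. (\<phi>(s := \<psi>)) j (\<lambda>(m, a). x (Aux j m a)))
      = \<psi> (\<lambda>(m, a). x (Aux s m a)) * (\<Prod>j\<in>{..<r} - {s}. \<phi> j (\<lambda>(m, a). x (Aux j m a)))"
    using assms by (subst prod.remove[of _ s]) (auto intro!: prod.cong)
  then show ?thesis by (simp add: outer_product_def)
qed

text \<open>By multilinearity, the elements of the spans can be replaced by generators one level at
  a time.\<close>

lemma outer_code_span:
  fixes S :: "nat \<Rightarrow> (nat \<times> nat, 'p::prime_card) state set"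
  shows "outer_code n' r k (\<lambda>j. qstate.span (S j))
    = qstate.span {outer_product n' r k \<phi> | \<phi>. \<forall>j<r. \<phi> j \<in> S j}" (is "_ = qstate.span ?T")
proof
  \<comment> \<open>The first \<open>s\<close> factors may be arbitrary elements of the spans, the
    remaining ones are generators; \<open>s = r\<close> is the goal.\<close>
  have "outer_product n' r k \<phi> \<in> qstate.span ?T"
    if "s \<le> r" "\<forall>j<s. \<phi> j \<in> qstate.span (S j)" "\<forall>j<r. s \<le> j \<longrightarrow> \<phi> j \<in> S j" for s \<phi>
    using that
  proof (induction s arbitrary: \<phi>)
    case 0
    then show ?case by (auto intro: qstate.span_base)
  next
    case (Suc s)
    let ?P = "\<lambda>\<psi>. outer_product n' r k (\<phi>(s := \<psi>))"
    have s: "s < r" using Suc.prems by simp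
    have "?P 0 = 0" "?P (a + b) = ?P a + ?P b" "?P (scale_state c a) = scale_state c (?P a)" for a b c
      by (auto simp: fun_eq_iff outer_product_fun_upd[OF s] scale_state_def algebra_simps)
    \<comment> \<open>The states admissible as factor \<open>s\<close> form a subspace; by the
      induction hypothesis it contains \<open>S s\<close>, hence its span.\<close>
    then have subspace: "qstate.subspace {\<psi>. ?P \<psi> \<in> qstate.span ?T}"
      unfolding qstate.subspace_def mem_Collect_eq
      by (simp only: qstate.span_zero qstate.span_add qstate.span_scale ball_simps simp_thms)
         (auto intro: qstate.span_add qstate.span_scale)
    have "S s \<subseteq> {\<psi>. ?P \<psi> \<in> qstate.span ?T}"
    proof safe
      fix \<psi> assume "\<psi> \<in> S s"
      then show "?P \<psi> \<in> qstate.span ?T"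
        by (intro Suc.IH) (use Suc.prems in auto)
    qed
    then have "qstate.span (S s) \<subseteq> {\<psi>. ?P \<psi> \<in> qstate.span ?T}"
      using subspace by (rule qstate.span_minimal)
    moreover have "\<phi> s \<in> qstate.span (S s)"
      using Suc.prems by simp
    ultimately have "?P (\<phi> s) \<in> qstate.span ?T"
      by (rule subsetD[THEN CollectD])
    then show ?case by simp
  qed
  from this[of r] have "{outer_product n' r k \<phi> | \<phi>. \<forall>j<r. \<phi> j \<in> qstate.span (S j)} \<subseteq> qstate.span ?T"
    by fastforce
  then show "outer_code n' r k (\<lambda>j. qstate.span (S j)) \<subseteq> qstate.span ?T"
    unfolding outer_code_def by (rule qstate.span_minimal) simp
  show "qstate.span ?T \<subseteq> outer_code n' r k (\<lambda>j. qstate.span (S j))"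
    unfolding outer_code_def by (rule qstate.span_mono) (auto intro: qstate.span_base)
qed

lemma span_scaled_image:
  fixes K :: complex and S :: "('v, 'p::prime_card) state set"
  assumes "K \<noteq> 0"
  shows "qstate.span (scale_state K ` S) = qstate.span S"
proof
  show "qstate.span (scale_state K ` S) \<subseteq> qstate.span S"
    by (rule qstate.span_minimal) (auto intro: qstate.span_scale qstate.span_base)
  show "qstate.span S \<subseteq> qstate.span (scale_state K ` S)"
  proof (rule qstate.span_minimal)
    show "S \<subseteq> qstate.span (scale_state K ` S)"
    proof
      fix \<phi> assume "\<phi> \<in> S"
      then have "scale_state (1 / K) (scale_state K \<phi>) \<in> qstate.span (scale_state K ` S)"
        by (intro qstate.span_scale qstate.span_base) auto
      then show "\<phi> \<in> qstate.span (scale_state K ` S)"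
        using assms by simp
    qed
  qed simp
qed

section \<open>Images of products of basis states\<close>

lemma Z_op_phase_state:
  "Z_op V c (scale_state K (phase_state V f)) = scale_state K (phase_state V (\<lambda>x. (\<Sum>v\<in>V. c v * x v) + f x))"
  by (auto simp: Z_op_def scale_state_def phase_state_def omega_pow_add fun_eq_iff)

text \<open>Forming the concatenated word is the transpose of the linear map from \<open>x\<close>
  to the sums at the auxiliary vertices, so the identity is an exchange of summations.\<close>

lemma concatenated_word_dot:
  fixes x :: "(vertex, 'p::prime_card) vec" and n n' r :: nat and k :: "nat \<Rightarrow> nat"
  defines "A \<equiv> aux_vertices n' r k" and "B \<equiv> out_vertices n' n"
  shows "(\<Sum>w\<in>B. concatenated_word n n' r k \<alpha> c w * x w)
    = (\<Sum>j<r. \<Sum>(m, a)\<in>outer_qupits n' k j. c j (m, a) *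
        (\<Sum>w\<in>B. cz_exponent \<alpha> (Aux j m a) w * x w))"
proof -
  have inner: "(\<Sum>w\<in>B. cz_exponent \<alpha> (Aux j m a) w * x w) = (\<Sum>l<n. \<alpha> j a l * x (Out m l))"
    if "m < n'" for j m a
  proof -
    have "(\<Sum>w\<in>B. cz_exponent \<alpha> (Aux j m a) w * x w)
        = (\<Sum>m'<n'. if m' = m then (\<Sum>l<n. \<alpha> j a l * x (Out m l)) else 0)"
      unfolding B_def sum_out_vertices by (intro sum.cong) auto
    then show ?thesis using that by simp
  qed
  have "(\<Sum>w\<in>B. concatenated_word n n' r k \<alpha> c w * x w)
      = (\<Sum>m<n'. \<Sum>l<n. (\<Sum>j<r. \<Sum>a<k j. c j (m, a) * \<alpha> j a l) * x (Out m l))"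
    unfolding B_def sum_out_vertices
    by (intro sum.cong refl) (simp add: concatenated_word_def codeword_def)
  also have "\<dots> = (\<Sum>m<n'. \<Sum>l<n. \<Sum>j<r. \<Sum>a<k j. c j (m, a) * (\<alpha> j a l * x (Out m l)))"
    by (simp add: sum_distrib_right mult.assoc)
  also have "\<dots> = (\<Sum>m<n'. \<Sum>j<r. \<Sum>l<n. \<Sum>a<k j. c j (m, a) * (\<alpha> j a l * x (Out m l)))"
    by (rule sum.cong[OF refl]) (rule sum.swap)
  also have "\<dots> = (\<Sum>m<n'. \<Sum>j<r. \<Sum>a<k j. \<Sum>l<n. c j (m, a) * (\<alpha> j a l * x (Out m l)))"
    by (rule sum.cong[OF refl], rule sum.cong[OF refl], rule sum.swap)
  also have "\<dots> = (\<Sum>j<r. \<Sum>m<n'. \<Sum>a<k j. c j (m, a) * (\<Sum>l<n. \<alpha> j a l * x (Out m l)))"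
    unfolding sum_distrib_left by (rule sum.swap)
  also have "\<dots> = (\<Sum>j<r. \<Sum>(m, a)\<in>outer_qupits n' k j. c j (m, a) *
        (\<Sum>w\<in>B. cz_exponent \<alpha> (Aux j m a) w * x w))"
    unfolding outer_qupits_def sum.cartesian_product[symmetric]
    by (intro sum.cong refl) (simp add: inner)
  finally show ?thesis .
qed

text \<open>The outer states are evaluated at \<open>y x\<close>, the inner copies at
  \<open>x\<close>. The supports are disjoint, so \<open>x + y x\<close> carries both arguments of
  \<open>product_form\<close>, and transposition turns the pairing of \<open>c\<close> with
  \<open>y x\<close> into that of the concatenated word with \<open>x\<close>. Each level and each
  inner copy contributes one scalar.\<close>

lemma encoding_circuit_product_state:
  fixes Gin :: "(nat, 'p::prime_card) mat" and n n' r :: nat and k :: "nat \<Rightarrow> nat"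
    and \<alpha> :: "nat \<Rightarrow> nat \<Rightarrow> (nat, 'p) vec"
  assumes inner: "graph_state {..<n} Gin = scale_state b (phase_state {..<n} fin)"
  defines "A \<equiv> aux_vertices n' r k" and "B \<equiv> out_vertices n' n"
  defines "y \<equiv> \<lambda>x u. if u \<in> A then \<Sum>w\<in>B. cz_exponent \<alpha> u w * x w else 0"
  shows "encoding_circuit n n' r k Gin \<alpha> (outer_product n' r k
      (\<lambda>j. Z_op (outer_qupits n' k j) (c j) (scale_state (a j) (phase_state (outer_qupits n' k j) (fout j)))))
    = scale_state ((\<Prod>j<r. a j) * b ^ n')
        (Z_op B (concatenated_word n n' r k \<alpha> c) (phase_state B (\<lambda>x. product_form n' r fout fin (x + y x))))"
    (is "encoding_circuit n n' r k Gin \<alpha> ?\<Phi> = scale_state ?K ?\<Psi>")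
proof (rule ext)
  fix x :: "(vertex, 'p) vec"
  show "encoding_circuit n n' r k Gin \<alpha> ?\<Phi> x = scale_state ?K ?\<Psi> x"
  proof (cases "x \<in> vecs B")
    case False
    then show ?thesis
      by (simp add: encoding_circuit_eq B_def scale_state_def Z_op_def phase_state_def)
  next
    case True
    have AB: "A \<inter> B = {}" unfolding A_def B_def by (rule aux_out_disjoint)
    have yA: "y x \<in> vecs A" by (simp add: y_def vecs_def)
    let ?Y = "\<lambda>j. (\<lambda>(m, a). y x (Aux j m a)) :: (nat \<times> nat, 'p) vec"
    let ?X = "\<lambda>m. (\<lambda>l. x (Out m l)) :: (nat, 'p) vec"
    have Y: "?Y j \<in> vecs (outer_qupits n' k j)" if "j < r" for j
      using that by (auto simp: vecs_def y_def A_def Aux_in_aux_vertices)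
    have X: "?X m \<in> vecs {..<n}" if "m < n'" for m
      using True that by (auto simp: vecs_def B_def Out_in_out_vertices)
    have \<Phi>: "?\<Phi> (y x) = (\<Prod>j<r. a j) * omega_pow ((\<Sum>j<r. \<Sum>v\<in>outer_qupits n' k j. c j v * ?Y j v)
        + (\<Sum>j<r. fout j (?Y j)))"
    proof -
      have "?\<Phi> (y x) = (\<Prod>j<r. Z_op (outer_qupits n' k j) (c j)
          (scale_state (a j) (phase_state (outer_qupits n' k j) (fout j))) (?Y j))"
        using yA by (simp only: outer_product_def A_def if_True)
      also have "\<dots> = (\<Prod>j<r. a j * omega_pow ((\<Sum>v\<in>outer_qupits n' k j. c j v * ?Y j v) + fout j (?Y j)))"
        unfolding Z_op_phase_state
        by (intro prod.cong refl) (simp add: Y scale_state_def phase_state_def)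
      finally show ?thesis
        by (simp only: prod.distrib omega_pow_sum[symmetric] sum.distrib)
    qed
    have I: "inner_copies n' n (graph_state {..<n} Gin) x = b ^ n' * omega_pow (\<Sum>m<n'. fin (?X m))"
    proof -
      have "inner_copies n' n (graph_state {..<n} Gin) x = (\<Prod>m<n'. b * omega_pow (fin (?X m)))"
        using True X unfolding B_def
        by (auto simp: inner_copies_def inner scale_state_def phase_state_def intro!: prod.cong)
      then show ?thesis
        by (simp add: prod.distrib omega_pow_sum[symmetric])
    qed
    have word: "(\<Sum>w\<in>B. concatenated_word n n' r k \<alpha> c w * x w)
        = (\<Sum>j<r. \<Sum>v\<in>outer_qupits n' k j. c j v * ?Y j v)"
      unfolding B_def concatenated_word_dot
      by (intro sum.cong refl) (auto simp: y_def A_def B_def Aux_in_aux_vertices)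
    have form: "product_form n' r fout fin (x + y x) = (\<Sum>j<r. fout j (?Y j)) + (\<Sum>m<n'. fin (?X m))"
    proof -
      have "(\<lambda>(m, a). (x + y x) (Aux j m a)) = ?Y j" for j
        using True by (auto simp: vecs_def B_def out_vertices_def)
      moreover have "(\<lambda>l. (x + y x) (Out m l)) = ?X m" for m
        by (auto simp: y_def A_def aux_vertices_def)
      ultimately show ?thesis by (simp only: product_form_def)
    qed
    have "encoding_circuit n n' r k Gin \<alpha> ?\<Phi> x = ?\<Phi> (y x) * inner_copies n' n (graph_state {..<n} Gin) x"
      using True unfolding encoding_circuit_eq y_def A_def B_def by simp
    moreover have "scale_state ?K ?\<Psi> x = ?K * (omega_pow (\<Sum>j<r. \<Sum>v\<in>outer_qupits n' k j. c j v * ?Y j v)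
        * omega_pow ((\<Sum>j<r. fout j (?Y j)) + (\<Sum>m<n'. fin (?X m))))"
      using True by (simp only: scale_state_def Z_op_def phase_state_def word form if_True)
    ultimately show ?thesis
      unfolding \<Phi> I by (simp only: omega_pow_add mult_ac)
  qed
qed

section \<open>The concatenated code\<close>

lemma encoding_graph_sym:
  assumes "\<And>u w. Gin u w = Gin w u" "\<And>j u w. j < r \<Longrightarrow> Gout j u w = Gout j w u"
  shows "encoding_graph n n' r k Gin \<alpha> Gout u w = encoding_graph n n' r k Gin \<alpha> Gout w u"
  using assms
  by (cases u; cases w) (auto simp: encoding_graph_def submatrix_on_def Aux_in_aux_vertices out_vertices_def)

lemma encoding_graph_diag:
  assumes "\<And>u. Gin u u = 0" "\<And>j u. j < r \<Longrightarrow> Gout j u u = 0"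
  shows "encoding_graph n n' r k Gin \<alpha> Gout u u = 0"
  using assms
  by (cases u) (auto simp: encoding_graph_def submatrix_on_def Aux_in_aux_vertices out_vertices_def)

lemma encoding_graph_aux_out:
  "u \<in> aux_vertices n' r k \<Longrightarrow> w \<in> out_vertices n' n \<Longrightarrow>
    encoding_graph n n' r k Gin \<alpha> Gout u w = cz_exponent \<alpha> u w"
  by (auto simp: encoding_graph_def submatrix_on_def aux_vertices_def out_vertices_def)

text \<open>Here both sides of the proof meet: this is the argument at which the circuit reads the
  outer state, and also the total shift that the local complementations apply to the auxiliary
  variables.\<close>

definition encoding_input ::
    "nat \<Rightarrow> nat \<Rightarrow> nat \<Rightarrow> (nat \<Rightarrow> nat) \<Rightarrow> (nat \<Rightarrow> nat \<Rightarrow> (nat, 'p::prime_card) vec)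
      \<Rightarrow> (vertex, 'p) vec \<Rightarrow> (vertex, 'p) vec" where
  "encoding_input n n' r k \<alpha> x =
     (\<lambda>u. if u \<in> aux_vertices n' r k then \<Sum>w\<in>out_vertices n' n. cz_exponent \<alpha> u w * x w else 0)"

text \<open>The local complementations shift the auxiliary variables by
  \<open>encoding_input\<close>, and removing the auxiliary vertices restricts the argument to
  \<open>B\<close>. The resulting form does not mention the order \<open>vs\<close>.\<close>

lemma graph_concatenation_along_form:
  fixes Gin :: "(nat, 'p::prime_card) mat" and n n' r :: nat and k :: "nat \<Rightarrow> nat"
  assumes Gin: "is_graph {..<n} Gin" "graph_form {..<n} Gin fin"
    and Gout: "\<And>j. j < r \<Longrightarrow> is_graph (outer_qupits n' k j) (Gout j)"
      "\<And>j. j < r \<Longrightarrow> graph_form (outer_qupits n' k j) (Gout j) (fout j)"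
    and along: "graph_concatenation_along vs (aux_vertices n' r k) (out_vertices n' n)
      (encoding_graph n n' r k Gin \<alpha> Gout) G"
  defines "B \<equiv> out_vertices n' n"
  shows "is_graph B G \<and>
    graph_form B G (\<lambda>x. product_form n' r fout fin (restr B x + encoding_input n n' r k \<alpha> (restr B x)))"
proof -
  let ?A = "aux_vertices n' r k"
  let ?E = "encoding_graph n n' r k Gin \<alpha> Gout"
  let ?v = "\<lambda>i. restr (out_neighbours B ?E i) (?E i)"
  obtain F where vs: "distinct vs" "set vs = ?A"
    and F: "glc_sequence ?v vs (delete_between ?A B ?E) F" and G: "G = submatrix_on B F"
    using along unfolding graph_concatenation_along_def B_def by blast
  have AB: "?A \<inter> B = {}" unfolding B_def by (rule aux_out_disjoint)
  have Esym: "?E u w = ?E w u" for u w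
    using Gin Gout by (intro encoding_graph_sym) (auto simp: is_graph_def)
  have Ediag: "?E u u = 0" for u
    using Gin Gout by (intro encoding_graph_diag) (auto simp: is_graph_def)
  have "(\<forall>u w. F u w = F w u) \<and> (\<forall>u. F u u = 0) \<and>
    graph_form (?A \<union> B) F (\<lambda>x. product_form n' r fout fin
      (x + (\<lambda>u. if u \<in> set vs then \<Sum>w\<in>?A \<union> B. ?v u w * x w else 0)))"
  proof (rule glc_sequence_graph_form[OF F])
    show "finite (?A \<union> B)" by (simp add: B_def)
    show "set vs \<subseteq> ?A \<union> B" "distinct vs" using vs by auto
    show "?v i u = 0" if "i \<in> set vs" "u \<in> set vs" for i u
      using that vs AB by (auto simp: restr_def out_neighbours_def)
    show "delete_between ?A B ?E u w = delete_between ?A B ?E w u" for u w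
      using Esym[of u w] by (auto simp: delete_between_def)
    show "delete_between ?A B ?E u u = 0" for u
      using Ediag by (simp add: delete_between_def)
    show "graph_form (?A \<union> B) (delete_between ?A B ?E) (product_form n' r fout fin)"
      unfolding B_def using Gin(2) Gout(2) by (rule graph_form_product_form)
  qed
  moreover have "(\<lambda>u. if u \<in> set vs then \<Sum>w\<in>?A \<union> B. ?v u w * x w else 0) = encoding_input n n' r k \<alpha> x"
    for x
  proof -
    \<comment> \<open>The recorded vector is zero on the auxiliary vertices and agrees with the
      exponents on \<open>B\<close>, since restricting to neighbours only drops zero labels.\<close>
    have "(\<Sum>w\<in>?A \<union> B. ?v u w * x w) = (\<Sum>w\<in>B. cz_exponent \<alpha> u w * x w)" if "u \<in> ?A" for u
      using AB encoding_graph_aux_out[OF that, of _ n Gin \<alpha> Gout]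
      by (intro sum.mono_neutral_cong_right) (auto simp: B_def restr_def out_neighbours_def)
    then show ?thesis by (auto simp: encoding_input_def vs B_def)
  qed
  ultimately have sym: "F u w = F w u" and diag: "F u u = 0"
    and form: "graph_form (?A \<union> B) F (\<lambda>x. product_form n' r fout fin (x + encoding_input n n' r k \<alpha> x))"
    for u w by simp_all
  have "is_graph B G"
    unfolding is_graph_def G submatrix_on_def using sym diag by (auto simp: B_def)
  moreover have "graph_form B G
      (\<lambda>x. product_form n' r fout fin (restr B x + encoding_input n n' r k \<alpha> (restr B x)))"
    unfolding G by (rule graph_form_submatrix[OF _ _ form]) (auto simp: B_def)
  ultimately show ?thesis ..
qed

text \<open>The circuit is linear, so it suffices to follow products of basis states. Each is sent
  to the basis state of its concatenated word, times a nonzero scalar that is the same for all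
  words; hence the spans agree.\<close>

lemma concatenated_quantum_code_eq_cws_code:
  fixes Gin :: "(nat, 'p::prime_card) mat" and n n' r :: nat and k :: "nat \<Rightarrow> nat"
    and \<alpha> :: "nat \<Rightarrow> nat \<Rightarrow> (nat, 'p) vec"
  assumes Gin: "is_graph {..<n} Gin" "graph_form {..<n} Gin fin"
    and Gout: "\<And>j. j < r \<Longrightarrow> is_graph (outer_qupits n' k j) (Gout j)"
      "\<And>j. j < r \<Longrightarrow> graph_form (outer_qupits n' k j) (Gout j) (fout j)"
    and Qout: "\<And>j. j < r \<Longrightarrow> Qout j = cws_code (outer_qupits n' k j) (Gout j) (Cout j)"
  defines "B \<equiv> out_vertices n' n"
  assumes G: "is_graph B G"
    "graph_form B G (\<lambda>x. product_form n' r fout fin (restr B x + encoding_input n n' r k \<alpha> (restr B x)))"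
      (is "graph_form B G ?f")
  shows "concatenated_quantum_code n n' r k Gin \<alpha> Qout
    = cws_code B G (concatenated_classical_code n n' r k \<alpha> Cout)"
proof -
  let ?V = "outer_qupits n' k"
  let ?circ = "encoding_circuit n n' r k Gin \<alpha>"
  let ?word = "concatenated_word n n' r k \<alpha>"
  obtain b where b: "b \<noteq> 0" "graph_state {..<n} Gin = scale_state b (phase_state {..<n} fin)"
    using graph_state_eq_phase_state[OF Gin] by blast
  obtain g where g: "g \<noteq> 0" "graph_state B G = scale_state g (phase_state B ?f)"
    using graph_state_eq_phase_state[OF G] by blast
  have "\<forall>j\<in>{..<r}. \<exists>a. a \<noteq> 0 \<and> graph_state (?V j) (Gout j) = scale_state a (phase_state (?V j) (fout j))"
    using graph_state_eq_phase_state[OF Gout] by auto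
  from bchoice[OF this] obtain a where a: "\<And>j. j < r \<Longrightarrow> a j \<noteq> 0"
      "\<And>j. j < r \<Longrightarrow> graph_state (?V j) (Gout j) = scale_state (a j) (phase_state (?V j) (fout j))"
    by auto
  \<comment> \<open>The scalars of the outer states and the inner copies, divided by the scalar of
    the target graph state.\<close>
  define K where "K = (\<Prod>j<r. a j) * b ^ n' / g"
  have K: "K \<noteq> 0"
    using a b g by (simp add: K_def)
  let ?S = "\<lambda>j. {Z_op (?V j) c (graph_state (?V j) (Gout j)) | c. c \<in> Cout j}"
  let ?prod = "\<lambda>c. outer_product n' r k (\<lambda>j. Z_op (?V j) (c j) (graph_state (?V j) (Gout j)))"
  have circ: "?circ (?prod c) = scale_state K (Z_op B (?word c) (graph_state B G))" for c
  proof -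
    have restr: "restr B x = x" if "x \<in> vecs B" for x :: "(vertex, 'p) vec"
      using that by (auto simp: restr_def vecs_def fun_eq_iff)
    have "?prod c = outer_product n' r k (\<lambda>j. Z_op (?V j) (c j) (scale_state (a j) (phase_state (?V j) (fout j))))"
      by (rule outer_product_cong) (simp add: a)
    then have "?circ (?prod c) = scale_state ((\<Prod>j<r. a j) * b ^ n') (Z_op B (?word c)
        (phase_state B (\<lambda>x. product_form n' r fout fin (x + encoding_input n n' r k \<alpha> x))))"
      unfolding B_def encoding_input_def by (simp only: encoding_circuit_product_state[OF b(2)])
    also have "phase_state B (\<lambda>x. product_form n' r fout fin (x + encoding_input n n' r k \<alpha> x))
        = scale_state (1 / g) (graph_state B G)"
      using g by (auto simp: phase_state_def scale_state_def restr fun_eq_iff)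
    also have "scale_state ((\<Prod>j<r. a j) * b ^ n') (Z_op B (?word c) (scale_state (1 / g) (graph_state B G)))
        = scale_state K (Z_op B (?word c) (graph_state B G))"
      by (auto simp: K_def Z_op_def scale_state_def fun_eq_iff)
    finally show ?thesis .
  qed
  \<comment> \<open>Codewords are chosen separately on the levels below \<open>r\<close>; their
    values at higher levels do not affect the product.\<close>
  have T: "{outer_product n' r k \<phi> | \<phi>. \<forall>j<r. \<phi> j \<in> ?S j} = {?prod c | c. \<forall>j<r. c j \<in> Cout j}"
  proof (intro subset_antisym subsetI)
    fix \<Phi> assume "\<Phi> \<in> {outer_product n' r k \<phi> | \<phi>. \<forall>j<r. \<phi> j \<in> ?S j}"
    then obtain \<phi> where \<Phi>: "\<Phi> = outer_product n' r k \<phi>" and "\<forall>j<r. \<phi> j \<in> ?S j" by blast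
    then have "\<forall>j\<in>{..<r}. \<exists>c. c \<in> Cout j \<and> \<phi> j = Z_op (?V j) c (graph_state (?V j) (Gout j))" by auto
    then obtain c where "\<forall>j\<in>{..<r}. c j \<in> Cout j \<and> \<phi> j = Z_op (?V j) (c j) (graph_state (?V j) (Gout j))"
      by (rule bchoice[THEN exE])
    then show "\<Phi> \<in> {?prod c | c. \<forall>j<r. c j \<in> Cout j}"
      unfolding \<Phi> by (auto intro!: outer_product_cong exI[of _ c])
  qed auto
  have "outer_code n' r k Qout = outer_code n' r k (\<lambda>j. qstate.span (?S j))"
    unfolding outer_code_def using Qout by (simp add: cws_code_def)
  also have "\<dots> = qstate.span {?prod c | c. \<forall>j<r. c j \<in> Cout j}"
    unfolding outer_code_span T ..
  finally have "concatenated_quantum_code n n' r k Gin \<alpha> Qout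
      = qstate.span (?circ ` {?prod c | c. \<forall>j<r. c j \<in> Cout j})"
    unfolding concatenated_quantum_code_def
    by (simp only: module_hom.span_image[OF linear_encoding_circuit])
  also have "?circ ` {?prod c | c. \<forall>j<r. c j \<in> Cout j} = scale_state K `
      {Z_op B w (graph_state B G) | w. w \<in> concatenated_classical_code n n' r k \<alpha> Cout}"
    unfolding concatenated_classical_code_def
    by (simp add: setcompr_eq_image image_image circ)
  finally show ?thesis
    unfolding cws_code_def span_scaled_image[OF K] .
qed

text \<open>Admissibility may fail midway when adjacent auxiliary vertices share an output
  neighbour. The conclusion therefore first treats every graph that the procedure yields, and then,
  with such sharing excluded, adds that every order succeeds and leads to one common graph.\<close>

theorem corollary2:
  fixes p n n' r :: nat
    and k q d K' d' :: "nat \<Rightarrow> nat"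
    and Gin :: "(nat, 'p::prime_card) mat"
    and Cin :: "(nat, 'p) vec set"
    and Qin :: "(nat, 'p) state set"
    and \<alpha> :: "nat \<Rightarrow> nat \<Rightarrow> (nat, 'p) vec"
    and Qsub :: "(nat, 'p) vec list \<Rightarrow> (nat, 'p) state set"
    and Gout :: "nat \<Rightarrow> (nat \<times> nat, 'p) mat"
    and Cout :: "nat \<Rightarrow> (nat \<times> nat, 'p) vec set"
    and Qout :: "nat \<Rightarrow> (nat \<times> nat, 'p) state set"
  defines "A \<equiv> aux_vertices n' r k"
    and "B \<equiv> out_vertices n' n"
    and "E \<equiv> encoding_graph n n' r k Gin \<alpha> Gout"
    and "Qgc \<equiv> concatenated_quantum_code n n' r k Gin \<alpha> Qout"
    and "Cgc \<equiv> concatenated_classical_code n n' r k \<alpha> Cout"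
  assumes p: "p = CARD('p)"
    and levels: "0 < r" "\<forall>j<r. 0 < k j \<and> q j = p ^ k j"
    and inner_graph: "is_graph {..<n} Gin"
    and inner_classical: "Cin \<subseteq> vecs {..<n}" "is_code_basis r k \<alpha> Cin"
    and inner_code: "Qin = cws_code {..<n} Gin Cin"
      "code_params id {..<n} Qin n (\<Prod>j<r. q j) (d 0) p"
    and decomposition: "nested_decomposition n r k q d Qin Qsub"
      "decomposition_corresponds n r k Gin \<alpha> Qsub"
      "\<forall>i j. i \<le> j \<and> j < r \<longrightarrow> d i \<le> d j"
    and outer_graphs: "\<forall>j<r. is_graph (outer_qupits n' k j) (Gout j)"
    and outer_classical: "\<forall>j<r. Cout j \<subseteq> vecs (outer_qupits n' k j)"
    and outer_codes: "\<forall>j<r. Qout j = cws_code (outer_qupits n' k j) (Gout j) (Cout j)"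
      "\<forall>j<r. code_params fst (outer_qupits n' k j) (Qout j) n' (K' j) (d' j) (q j)"
  shows "(\<forall>Ggc. graph_concatenation A B E Ggc \<longrightarrow> is_graph B Ggc \<and> Qgc = cws_code B Ggc Cgc) \<and>
    ((\<forall>i\<in>A. \<forall>i'\<in>A. E i i' \<noteq> 0 \<longrightarrow> out_neighbours B E i \<inter> out_neighbours B E i' = {}) \<longrightarrow>
      (\<exists>Ggc. (\<forall>vs. distinct vs \<and> set vs = A \<longrightarrow> graph_concatenation_along vs A B E Ggc) \<and>
        is_graph B Ggc \<and> Qgc = cws_code B Ggc Cgc))"
proof -
  have AB: "A \<inter> B = {}" unfolding A_def B_def by (rule aux_out_disjoint)
  obtain fin where fin: "graph_form {..<n} Gin fin"
    using ex_graph_form[of "{..<n}" Gin] inner_graph unfolding is_graph_def by blast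
  have "\<forall>j\<in>{..<r}. \<exists>f. graph_form (outer_qupits n' k j) (Gout j) f"
    using outer_graphs by (auto simp: is_graph_def intro!: ex_graph_form)
  from bchoice[OF this] obtain fout where
    fout: "\<And>j. j < r \<Longrightarrow> graph_form (outer_qupits n' k j) (Gout j) (fout j)"
    by auto
  have Gout: "is_graph (outer_qupits n' k j) (Gout j)"
    and Qout: "Qout j = cws_code (outer_qupits n' k j) (Gout j) (Cout j)" if "j < r" for j
    using outer_graphs outer_codes that by auto
  let ?f = "\<lambda>x. product_form n' r fout fin (restr B x + encoding_input n n' r k \<alpha> (restr B x))"
  have form: "is_graph B Ggc" "graph_form B Ggc ?f" if "graph_concatenation_along vs A B E Ggc" for vs Ggc
    using graph_concatenation_along_form[OF inner_graph fin Gout fout that[unfolded A_def B_def E_def]]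
    unfolding B_def by blast+
  have code: "Qgc = cws_code B Ggc Cgc" if "graph_concatenation_along vs A B E Ggc" for vs Ggc
    unfolding Qgc_def Cgc_def B_def
    by (rule concatenated_quantum_code_eq_cws_code
        [OF inner_graph fin Gout fout Qout form[OF that, unfolded B_def]])
  have "\<exists>Ggc. (\<forall>vs. distinct vs \<and> set vs = A \<longrightarrow> graph_concatenation_along vs A B E Ggc) \<and>
        is_graph B Ggc \<and> Qgc = cws_code B Ggc Cgc"
    if disj: "\<forall>i\<in>A. \<forall>i'\<in>A. E i i' \<noteq> 0 \<longrightarrow> out_neighbours B E i \<inter> out_neighbours B E i' = {}"
  proof -
    let ?v = "\<lambda>i. restr (out_neighbours B E i) (E i)"
    have Esym: "E u w = E w u" for u w
      unfolding E_def using inner_graph Gout by (intro encoding_graph_sym) (auto simp: is_graph_def)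
    have ex: "\<exists>Ggc. graph_concatenation_along vs A B E Ggc" if "distinct vs \<and> set vs = A" for vs
    proof -
      have "\<exists>F. glc_sequence ?v vs (delete_between A B E) F"
      \<comment> \<open>Initially the invariant holds vacuously: all edges between \<open>A\<close>
        and \<open>B\<close> have been deleted.\<close>
      proof (rule glc_sequence_exists[where A = A and B = B and N = E])
        show "?v i u = 0" if "i \<in> A" "u \<notin> B" for i u
          using that by (auto simp: restr_def out_neighbours_def)
        show "?v i w = 0 \<or> ?v i' w = 0" if "i \<in> A" "i' \<in> A" "E i i' \<noteq> 0" for i i' w
          using disj that by (auto simp: restr_def)
        show "delete_between A B E u w = delete_between A B E w u" for u w
          using Esym[of u w] by (auto simp: delete_between_def)
      qed (use that AB in \<open>auto simp: delete_between_def\<close>)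
      then show ?thesis
        using that unfolding graph_concatenation_along_def by blast
    qed
    obtain vs0 where vs0: "distinct vs0 \<and> set vs0 = A"
      using finite_distinct_list[of A] unfolding A_def by auto
    obtain Ggc where Ggc: "graph_concatenation_along vs0 A B E Ggc"
      using ex[OF vs0] by blast
    have "graph_concatenation_along vs A B E Ggc" if vs: "distinct vs \<and> set vs = A" for vs
    proof -
      obtain G where G: "graph_concatenation_along vs A B E G"
        using ex[OF vs] by blast
      \<comment> \<open>Both graphs have the same form \<open>?f\<close>, which determines the
        entries within \<open>B\<close>; all other entries are \<open>0\<close>.\<close>
      have "G u w = Ggc u w" for u w
      proof (cases "u \<in> B \<and> w \<in> B")
        case True
        then show ?thesis
          using graph_form_unique[OF _ form(2)[OF G] form(2)[OF Ggc]] by (simp add: B_def)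
      next
        case False
        then show ?thesis
          using form(1)[OF G] form(1)[OF Ggc] by (auto simp: is_graph_def)
      qed
      then have "G = Ggc" by (intro ext)
      with G show ?thesis by simp
    qed
    with form(1)[OF Ggc] code[OF Ggc] show ?thesis by blast
  qed
  moreover have "\<forall>Ggc. graph_concatenation A B E Ggc \<longrightarrow> is_graph B Ggc \<and> Qgc = cws_code B Ggc Cgc"
    unfolding graph_concatenation_def using form(1) code by blast
  ultimately show ?thesis by blast
qed

end
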